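(* Let $G=(V,E)$ be a connected undirected simple graph with maximum degree $\Delta$, $k$ a positive integer and $v_i\in V$. The call ENUM-V$(G,\{v_i\},k)$ runs in $O(N_i\cdot k\cdot\min\{k,\Delta\})$ time, where $N_i$ is the number of $k$-graphlets of $G$ that contain $v_i$. In particular, if $\Delta=O(1)$ it runs in $O(k\cdot N_i)$ time.
   Context: A $k$-graphlet is a connected subgraph induced by exactly $k$ vertices. $N(U)=\bigcup_{u\in U}N(u)\setminus U$. A vertex $v$ is mandatory for $G,\mathit{In},k$ if the connected component of $G-v$ containing $\mathit{In}$ has at most $k-1$ vertices; this is tested by a breadth-first search from $\mathit{In}$ that stops as soon as $k$ vertices are found. LIN-ENUM-V$(G,\mathit{In},k)$: if $|\mathit{In}|=k$ output $\mathit{In}$ and return; while $N(\mathit{In})$ has a mandatory vertex $u$, add $u$ to $\mathit{In}$ (outputting and returning if $|\mathit{In}|=k$); then pick $v\in N(\mathit{In})$ and call LIN-ENUM-V$(G,\mathit{In}\cup\{v\},k)$ and LIN-ENUM-V$(G-v,\mathit{In},k)$. ENUM-V$(G,\mathit{In},k)$: (1) if $|\mathit{In}|=k-1$, output $\mathit{In}\cup\{u\}$ for every $u\in N(\mathit{In})$, then return; (2) while $|N(\mathit{In})|=1$: add the unique vertex of $N(\mathit{In})$ to $\mathit{In}$, and if $|\mathit{In}|=k-1$, output $\mathit{In}\cup\{u\}$ for every $u\in N(\mathit{In})$ and return; (3) let $x,y$ be distinct vertices of $N(\mathit{In})$; if one of them, $z$, is non-mandatory, call ENUM-V$(G,\mathit{In}\cup\{z\},k)$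 and ENUM-V$(G-z,\mathit{In},k)$; otherwise call LIN-ENUM-V$(G,\mathit{In},k)$. The graph is stored in adjacency lists, with vertex deletion in $O(\deg(v))$ time.
   Formalization: Assumes k ≤ |V| and, in the first bound, Δ > 0 (otherwise the bound is 0); for k = 1 ENUM-V outputs In at once; LIN-ENUM-V finds all mandatory vertices by a single depth-first search, since one breadth-first search per vertex violates the bound (e.g. on K_k). *)

theory Defs
  imports "Graph_Theory.Graph_Theory"
begin

section \<open>Graphlets and maximum degree\<close>

text \<open>Undirected simple graphs are the (finite) symmetric loop-free digraphs without multiple arcs
  of the locale \<^locale>\<open>graph\<close>; an undirected edge is a pair of opposite arcs, so that the degree of
  a vertex is its out-degree.\<close>

definition max_degree :: "('a, 'b) pre_digraph \<Rightarrow> nat" where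
  "max_degree G = Max (out_degree G ` verts G)"

text \<open>An induced subgraph is identified with its vertex set.\<close>

definition graphlets_at :: "('a, 'b) pre_digraph \<Rightarrow> nat \<Rightarrow> 'a \<Rightarrow> 'a set set" where
  "graphlets_at G k v = {S. S \<subseteq> verts G \<and> card S = k \<and> connected (G \<restriction> S) \<and> v \<in> S}"


section \<open>Programs with running time\<close>

text \<open>\<^term>\<open>Some (x, t)\<close>: the computation terminates after \<open>t\<close> steps with result \<open>x\<close>;
  \<^term>\<open>None\<close>: it does not terminate.\<close>

type_synonym 'r timed = "('r \<times> nat) option"

definition ret :: "'r \<Rightarrow> 'r timed" where
  "ret x = Some (x, 0)"

definition andthen :: "'r timed \<Rightarrow> ('r \<Rightarrow> 's timed) \<Rightarrow> 's timed"  (infixr \<open>\<rhd>\<close> 54) where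
  "m \<rhd> f = Option.bind m (\<lambda>(x, t). Option.bind (f x) (\<lambda>(y, u). Some (y, t + u)))"

definition charge :: "nat \<Rightarrow> 'r timed \<Rightarrow> 'r timed" where
  "charge n m = Some ((), n) \<rhd> (\<lambda>_. m)"

lemma andthen_mono [partial_function_mono]:
  assumes "mono_option B" and "\<And>y. mono_option (\<lambda>f. C y f)"
  shows "mono_option (\<lambda>f. B f \<rhd> (\<lambda>y. C y f))"
  unfolding andthen_def case_prod_beta
  by (intro bind_mono assms option.const_mono)

lemma charge_mono [partial_function_mono]:
  assumes "mono_option B"
  shows "mono_option (\<lambda>f. charge n (B f))"
  unfolding charge_def by (intro andthen_mono assms option.const_mono)


section \<open>Adjacency lists\<close>

text \<open>
  The machine is a RAM. The graph is an array of doubly linked adjacency lists in which the two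
  records of an edge point to each other. Vertex-indexed arrays (membership in \<open>In\<close>,
  membership in the set of vertices found by a search, depth-first numbers, \<dots>) are allocated once
  and are cleaned after each search by going again through the vertices the search has written to,
  which at most doubles its time. So inspecting one list entry, testing or recording a mark,
  dequeuing or enqueuing a vertex are constant time operations, and the searches below are charged
  1 for each inspected entry and 1 for each vertex loaded or dequeued.
  The set \<open>In\<close> is a stack, kept together with its size.
\<close>

type_synonym 'a adj = "'a \<Rightarrow> 'a list"

definition adjacency_lists :: "('a, 'b) pre_digraph \<Rightarrow> 'a adj \<Rightarrow> bool" where
  "adjacency_lists G A \<longleftrightarrow> (\<forall>u \<in> verts G. distinct (A u) \<and> set (A u) = {w. u \<rightarrow>\<^bsub>G\<^esub> w})"

definition delete :: "'a \<Rightarrow> 'a adj \<Rightarrow> 'a adj" where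
  "delete v A = (\<lambda>u. if u = v then [] else removeAll v (A u))"

text \<open>Deletion, and later re-insertion when the recursive call on the smaller graph has returned.\<close>

definition deletion_time :: "'a \<Rightarrow> 'a adj \<Rightarrow> nat" where
  "deletion_time v A = 2 * Suc (length (A v))"


section \<open>Mandatory vertices\<close>

text \<open>The component of \<open>G - v\<close> that contains \<open>In\<close>.\<close>

definition component_without :: "('a, 'b) pre_digraph \<Rightarrow> 'a \<Rightarrow> 'a set \<Rightarrow> 'a set" where
  "component_without G v In = {w. \<exists>u \<in> In. u \<rightarrow>\<^sup>*\<^bsub>pre_digraph.del_vert G v\<^esub> w}"

definition mandatory :: "('a, 'b) pre_digraph \<Rightarrow> 'a set \<Rightarrow> nat \<Rightarrow> 'a \<Rightarrow> bool" where
  "mandatory G In k v \<longleftrightarrow> card (component_without G v In) \<le> k - 1"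

text \<open>
  Breadth-first search in \<open>G - v\<close>: \<open>S\<close> are the vertices found, \<open>Q\<close> is the queue and \<open>ws\<close> the unread
  part of the list of the vertex dequeued last. The result is \<^term>\<open>True\<close> iff the search
  ends before \<open>k\<close> vertices are found.
\<close>

partial_function (option) bfs :: "'a adj \<Rightarrow> nat \<Rightarrow> 'a \<Rightarrow> 'a list \<Rightarrow> 'a list \<Rightarrow> 'a list \<Rightarrow> bool timed" where
  "bfs A k v S Q ws =
    (case ws of
       [] \<Rightarrow> (case Q of
          [] \<Rightarrow> ret True
        | q # Q' \<Rightarrow> charge 1 (bfs A k v S Q' (A q)))
     | w # ws' \<Rightarrow> charge 1 (
          if w = v \<or> w \<in> set S then bfs A k v S Q ws'
          else if Suc (length S) = k then ret False
          else bfs A k v (w # S) (Q @ [w]) ws'))"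

definition is_mandatory :: "'a adj \<Rightarrow> 'a list \<Rightarrow> nat \<Rightarrow> 'a \<Rightarrow> bool timed" where
  "is_mandatory A In k v = charge (length In) (bfs A k v In In [])"

text \<open>
  The following search is used in LIN-ENUM-V, whose calls must take linear time in the component of \<open>In\<close>; one
  breadth-first search per vertex would already take time of order \<open>k\<^sup>3\<close> on the complete graph with \<open>k\<close>
  vertices, which has only one graphlet.
  All mandatory vertices are found at once, by a depth-first search with low points in which the vertices of
  \<open>In\<close> are merged into a root with number 0.
  \<open>num\<close> are the depth-first numbers, \<open>c\<close> is the next one, and \<open>sep v\<close> counts the vertices that the
  removal of \<open>v\<close> separates from the root.
  \<open>dfs A p low sz ws (num, c, sep)\<close> treats the unread part \<open>ws\<close> of the list of \<open>p\<close>; it returns the new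
  arrays, the low point of \<open>p\<close> and the number of its descendants (\<open>low\<close> and \<open>sz\<close> are
  their current values).
\<close>

type_synonym 'a dfs_state = "('a \<Rightarrow> nat option) \<times> nat \<times> ('a \<Rightarrow> nat)"

partial_function (option) dfs ::
  "'a adj \<Rightarrow> 'a \<Rightarrow> nat \<Rightarrow> nat \<Rightarrow> 'a list \<Rightarrow> 'a dfs_state \<Rightarrow> ('a dfs_state \<times> nat \<times> nat) timed" where
  "dfs A p low sz ws st =
    (case ws of
       [] \<Rightarrow> charge 1 (ret (st, low, sz))
     | w # ws' \<Rightarrow> charge 1 (case st of (num, c, sep) \<Rightarrow>
         (case num w of
            Some i \<Rightarrow> dfs A p (min low i) sz ws' st
          | None \<Rightarrow>
              dfs A w c 1 (A w) (num(w \<mapsto> c), Suc c, sep) \<rhd> (\<lambda>((num', c', sep'), l, s).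
              dfs A p (min low l) (sz + s) ws'
                (num', c', if the (num' p) \<le> l then sep'(p := sep' p + s) else sep')))))"

fun dfs_roots :: "'a adj \<Rightarrow> 'a list \<Rightarrow> nat \<Rightarrow> 'a dfs_state \<Rightarrow> ('a dfs_state \<times> nat) timed" where
  "dfs_roots A [] n st = ret (st, n)"
| "dfs_roots A (q # qs) n st =
    charge 1 (dfs A q 0 1 (A q) st \<rhd> (\<lambda>(st', _, s). dfs_roots A qs (n + s) st'))"

definition all_mandatory :: "'a adj \<Rightarrow> 'a list \<Rightarrow> nat \<Rightarrow> ('a \<Rightarrow> bool) timed" where
  "all_mandatory A In k =
    charge (length In) (
      dfs_roots A In 0 (\<lambda>v. if v \<in> set In then Some 0 else None, 1, \<lambda>_. 0) \<rhd>
      (\<lambda>((num, c, sep), n). ret (\<lambda>v. n - Suc (sep v) \<le> k - 1)))"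


section \<open>LIN-ENUM-V\<close>

text \<open>
  The while loop. \<open>Q\<close> are the vertices of \<open>In\<close> whose lists have not been read, \<open>ws\<close> is the unread part
  of the current list, and \<open>c\<close> is a non-mandatory vertex of \<open>N(In)\<close> that has been seen. As long as \<open>G\<close>
  does not change, adding vertices to \<open>In\<close> does not change which vertices are mandatory.
\<close>

partial_function (option) add_mandatory ::
  "'a adj \<Rightarrow> nat \<Rightarrow> ('a \<Rightarrow> bool) \<Rightarrow> 'a list \<Rightarrow> 'a option \<Rightarrow> 'a list \<Rightarrow> 'a list \<Rightarrow> ('a list \<times> 'a option) timed" where
  "add_mandatory A k mand In c Q ws =
    (case ws of
       [] \<Rightarrow> (case Q of
          [] \<Rightarrow> ret (In, c)
        | q # Q' \<Rightarrow> charge 1 (add_mandatory A k mand In c Q' (A q)))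
     | w # ws' \<Rightarrow> charge 1 (
          if w \<in> set In then add_mandatory A k mand In c Q ws'
          else if \<not> mand w then add_mandatory A k mand In (Some w) Q ws'
          else if Suc (length In) = k then ret (w # In, None)
          else add_mandatory A k mand (w # In) c (Q @ [w]) ws'))"

definition emit :: "'a set \<Rightarrow> 'a set list timed" where
  "emit S = charge (card S) (ret [S])"

text \<open>The result is the list of all outputs. The case \<^term>\<open>None\<close> (\<open>N(In)\<close> is empty) does not
  occur if the component of \<open>In\<close> has at least \<open>k\<close> vertices.\<close>

partial_function (option) lin_enum_v :: "'a adj \<Rightarrow> 'a list \<Rightarrow> nat \<Rightarrow> 'a set list timed" where
  "lin_enum_v A In k =
    charge 1 (
      if length In = k then emit (set In)
      else
        all_mandatory A In k \<rhd> (\<lambda>mand.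
        charge (length In) (add_mandatory A k mand In None In []) \<rhd> (\<lambda>(In', c).
        if length In' = k then emit (set In')
        else (case c of
            None \<Rightarrow> ret []
          | Some v \<Rightarrow>
              lin_enum_v A (v # In') k \<rhd> (\<lambda>out1.
              charge (deletion_time v A) (lin_enum_v (delete v A) In' k) \<rhd> (\<lambda>out2.
              ret (out1 @ out2)))))))"


section \<open>ENUM-V\<close>

text \<open>Output \<open>In \<union> {u}\<close> for every \<open>u \<in> N(In)\<close>: all lists of \<open>In\<close> are read once, and writing one
  output takes time \<open>|In| + 1\<close>.\<close>

definition emit_all :: "'a adj \<Rightarrow> 'a list \<Rightarrow> 'a set list timed" where
  "emit_all A In =
    (let entries = concat (map A In);
         us = remdups (filter (\<lambda>u. u \<notin> set In) entries)
     in charge (length In + length entries + Suc (length In) * length us)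
          (ret (map (\<lambda>u. insert u (set In)) us)))"

datatype 'a extension =
    Full "'a list"
  | Branch "'a list" 'a 'a
  | Stuck

text \<open>
  The while loop of ENUM-V. The lists of the vertices of \<open>In\<close> are read until two vertices of \<open>N(In)\<close> are
  found; \<open>c\<close> is the first of them. If only one is found then it is added to \<open>In\<close>, and only its
  list remains to be read, as all other neighbours of \<open>In\<close> are in \<open>In\<close>.
  The result is \<open>Full In'\<close> if \<open>|In'| = k - 1\<close> is reached, and \<open>Branch In' x y\<close> if distinct
  \<open>x, y \<in> N(In')\<close> are found; \<open>Stuck\<close> (\<open>N(In)\<close> is empty) does not occur if the component of \<open>In\<close>
  has at least \<open>k\<close> vertices.
\<close>

partial_function (option) extend ::
  "'a adj \<Rightarrow> nat \<Rightarrow> 'a list \<Rightarrow> 'a option \<Rightarrow> 'a list \<Rightarrow> 'a list \<Rightarrow> 'a extension timed" where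
  "extend A k In c Q ws =
    (case ws of
       [] \<Rightarrow> (case Q of
          [] \<Rightarrow> (case c of
             None \<Rightarrow> ret Stuck
           | Some u \<Rightarrow> charge 1 (
               if Suc (length In) = k - 1 then ret (Full (u # In))
               else extend A k (u # In) None [] (A u)))
        | q # Q' \<Rightarrow> charge 1 (extend A k In c Q' (A q)))
     | w # ws' \<Rightarrow> charge 1 (
          if w \<in> set In \<or> c = Some w then extend A k In c Q ws'
          else (case c of
             None \<Rightarrow> extend A k In (Some w) Q ws'
           | Some u \<Rightarrow> ret (Branch In u w))))"

text \<open>The test \<open>k \<le> |In|\<close> only concerns \<open>k = 1\<close>, where the initial set is the unique solution; for
  \<open>k \<ge> 2\<close> all calls have \<open>|In| \<le> k - 1\<close>.\<close>

partial_function (option) enum_v :: "'a adj \<Rightarrow> 'a list \<Rightarrow> nat \<Rightarrow> 'a set list timed" where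
  "enum_v A In k =
    charge 1 (
      if k \<le> length In then emit (set In)
      else if length In = k - 1 then emit_all A In
      else
        charge (length In) (extend A k In None In []) \<rhd> (\<lambda>r.
        (case r of
           Full In' \<Rightarrow> emit_all A In'
         | Stuck \<Rightarrow> ret []
         | Branch In' x y \<Rightarrow>
             is_mandatory A In' k x \<rhd> (\<lambda>mx.
             (if mx then is_mandatory A In' k y else ret False) \<rhd> (\<lambda>mxy.
             if mxy then lin_enum_v A In' k
             else let z = (if mx then y else x) in
               enum_v A (z # In') k \<rhd> (\<lambda>out1.
               charge (deletion_time z A) (enum_v (delete z A) In' k) \<rhd> (\<lambda>out2.
               ret (out1 @ out2))))))))"


section \<open>The two searches decide whether a vertex is mandatory\<close>

text \<open>The results are the last two lemmas.\<close>

definition avoiding :: "'a adj \<Rightarrow> 'a set \<Rightarrow> 'a set \<Rightarrow> 'a set" where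
  "avoiding A X B = {(u, w). w \<in> set (A u) \<and> w \<notin> X}\<^sup>* `` B"

lemma avoiding_base: "b \<in> B \<Longrightarrow> b \<in> avoiding A X B"
  unfolding avoiding_def by blast

lemma avoiding_step: "u \<in> avoiding A X B \<Longrightarrow> w \<in> set (A u) \<Longrightarrow> w \<notin> X \<Longrightarrow> w \<in> avoiding A X B"
  unfolding avoiding_def by (auto intro: rtrancl_into_rtrancl)

lemma avoiding_induct [consumes 1, case_names base step]:
  assumes "x \<in> avoiding A X B"
    and "\<And>b. b \<in> B \<Longrightarrow> P b"
    and "\<And>u w. u \<in> avoiding A X B \<Longrightarrow> P u \<Longrightarrow> w \<in> set (A u) \<Longrightarrow> w \<notin> X \<Longrightarrow> P w"
  shows "P x"
proof -
  from assms(1) obtain b where b: "b \<in> B" "(b, x) \<in> {(u, w). w \<in> set (A u) \<and> w \<notin> X}\<^sup>*"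
    unfolding avoiding_def by blast
  from b(2) have "P x \<and> x \<in> avoiding A X B"
  proof (induction rule: rtrancl_induct)
    case base
    then show ?case using b(1) assms(2) avoiding_base by fast
  next
    case (step y z)
    then show ?case using assms(3)[of y z] avoiding_step[of y A X B z] by blast
  qed
  then show ?thesis ..
qed

lemma avoiding_least:
  assumes "B \<subseteq> M" and "\<And>u w. u \<in> M \<Longrightarrow> w \<in> set (A u) \<Longrightarrow> w \<notin> X \<Longrightarrow> w \<in> M"
  shows "avoiding A X B \<subseteq> M"
proof
  fix x assume "x \<in> avoiding A X B"
  then show "x \<in> M" by (induction rule: avoiding_induct) (use assms in blast)+
qed

lemma charge_Some [simp]: "charge n (Some (x, t)) = Some (x, n + t)"
  by (simp add: charge_def andthen_def)


lemma bfs_correct: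
  assumes "finite (avoiding A {v} B)"
    and "B \<subseteq> set S" "set S \<subseteq> avoiding A {v} B" "distinct S" "length S < k"
    and "set Q \<subseteq> set S" "set ws \<subseteq> insert v (avoiding A {v} B)"
    and "\<forall>u \<in> set S - set Q. set (A u) \<subseteq> insert v (set S \<union> set ws)"
  shows "\<exists>t. bfs A k v S Q ws = Some (card (avoiding A {v} B) \<le> k - 1, t)"
  using assms
proof (induction "(k - length S, length Q, length ws)" arbitrary: S Q ws
    rule: wf_induct_rule[OF wf_lex_prod[OF wf_less_than wf_lex_prod[OF wf_less_than wf_less_than]]])
  case (1 S Q ws)
  note IH = 1(1)[OF _ 1(2)] and fin = 1(2)
  note a = 1(3) 1(4) 1(5) 1(6) 1(7) 1(8) 1(9)
  let ?R = "avoiding A {v} B"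
  show ?case
  proof (cases ws)
    case Nil
    show ?thesis
    proof (cases Q)
      case Q: Nil
      have "?R \<subseteq> set S"
      proof (rule avoiding_least)
        fix u w assume "u \<in> set S" "w \<in> set (A u)" "w \<notin> {v}"
        then show "w \<in> set S" using a(7) Nil Q by auto
      qed (rule a)
      with a have "?R = set S" by blast
      then have "card ?R = length S" using a(3) distinct_card by metis
      then show ?thesis using a(4) by (subst bfs.simps) (simp add: Nil Q ret_def)
    next
      case (Cons q Q')
      have "set (A q) \<subseteq> insert v ?R" using avoiding_step[of q A "{v}" B] a Cons by auto
      moreover have "\<forall>u \<in> set S - set Q'. set (A u) \<subseteq> insert v (set S \<union> set (A q))"
        using a(7) Cons Nil by auto
      ultimately have "\<exists>t. bfs A k v S Q' (A q) = Some (card ?R \<le> k - 1, t)"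
        using a(5) Cons by (intro IH a(1-4)) auto
      then show ?thesis by (subst bfs.simps) (auto simp: Nil Cons)
    qed
  next
    case (Cons w ws')
    consider (old) "w = v \<or> w \<in> set S" | (full) "\<not> (w = v \<or> w \<in> set S)" "Suc (length S) = k"
      | (new) "\<not> (w = v \<or> w \<in> set S)" "Suc (length S) \<noteq> k" by blast
    then show ?thesis
    proof cases
      case old
      have "\<forall>u \<in> set S - set Q. set (A u) \<subseteq> insert v (set S \<union> set ws')"
        using a(7) Cons old by auto
      then have "\<exists>t. bfs A k v S Q ws' = Some (card ?R \<le> k - 1, t)"
        using a(6) Cons by (intro IH a(1-5)) auto
      then show ?thesis using old by (subst bfs.simps) (auto simp: Cons)
    next
      case full
      have "set (w # S) \<subseteq> ?R" using full a(2,6) Cons by auto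
      then have "card (set (w # S)) \<le> card ?R" using fin by (rule card_mono[rotated])
      then have "k \<le> card ?R" using full a(3) by (simp add: distinct_card)
      then show ?thesis using full by (subst bfs.simps) (auto simp: Cons ret_def)
    next
      case new
      have "\<forall>u \<in> set (w # S) - set (Q @ [w]). set (A u) \<subseteq> insert v (set (w # S) \<union> set ws')"
        using a(7) Cons new by auto
      moreover have "set (w # S) \<subseteq> ?R" using new a(2,6) Cons by auto
      moreover have "length (w # S) < k" using new a(4) by simp
      ultimately have "\<exists>t. bfs A k v (w # S) (Q @ [w]) ws' = Some (card ?R \<le> k - 1, t)"
        using a(1,3,5,6) new Cons by (intro IH) auto
      then show ?thesis using new by (subst bfs.simps) (auto simp: Cons)
    qed
  qed
qed


lemma avoiding_mono: "X \<subseteq> Y \<Longrightarrow> B \<subseteq> B' \<Longrightarrow> avoiding A Y B \<subseteq> avoiding A X B'"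
  by (rule avoiding_least) (auto intro: avoiding_base avoiding_step)

lemma avoiding_trans: "B \<subseteq> avoiding A X B' \<Longrightarrow> avoiding A X B \<subseteq> avoiding A X B'"
  by (rule avoiding_least) (auto intro: avoiding_step)

lemma avoiding_disjoint: "B \<inter> X = {} \<Longrightarrow> avoiding A X B \<inter> X = {}"
  using avoiding_least[of B "- X" A X] by blast

locale adj_graph =
  fixes A :: "'a adj" and V I :: "'a set"
  assumes fin: "finite V"
    and closed: "u \<in> V \<Longrightarrow> w \<in> set (A u) \<Longrightarrow> w \<in> V"
    and sym: "u \<in> V \<Longrightarrow> w \<in> set (A u) \<Longrightarrow> u \<in> set (A w)"
    and I: "I \<subseteq> V"
begin

lemma avoiding_V: "B \<subseteq> V \<Longrightarrow> avoiding A X B \<subseteq> V"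
  by (rule avoiding_least) (auto intro: closed)

lemma avoiding_sym:
  assumes "d \<in> avoiding A M {w}" "w \<in> V" "w \<notin> M"
  shows "w \<in> avoiding A M {d}"
proof -
  have "avoiding A M {w} \<subseteq> {d \<in> V - M. w \<in> avoiding A M {d}}"
  proof (rule avoiding_least)
    fix u y assume u: "u \<in> {d \<in> V - M. w \<in> avoiding A M {d}}" and y: "y \<in> set (A u)" "y \<notin> M"
    have "u \<in> avoiding A M {y}"
      using u y sym[of u y] avoiding_base[of y "{y}" A M] avoiding_step[of y A M "{y}" u] by blast
    then have "w \<in> avoiding A M {y}" using u avoiding_trans[of "{u}" A M "{y}"] by blast
    then show "y \<in> {d \<in> V - M. w \<in> avoiding A M {d}}" using u y closed by blast
  qed (use assms in \<open>auto intro: avoiding_base\<close>)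
  then show ?thesis using assms(1) by blast
qed

lemma avoiding_eq:
  assumes "d \<in> avoiding A M {w}" "w \<in> V" "w \<notin> M"
  shows "avoiding A M {d} = avoiding A M {w}"
  using avoiding_sym[OF assms] assms(1) avoiding_trans[of "{d}" A M "{w}"]
    avoiding_trans[of "{w}" A M "{d}"] by blast

lemma avoiding_insert:
  assumes "w \<notin> M"
  shows "avoiding A M {w} = insert w (avoiding A (insert w M) (set (A w) - insert w M))"
proof
  let ?D = "avoiding A (insert w M) (set (A w) - insert w M)"
  show "avoiding A M {w} \<subseteq> insert w ?D"
  proof (rule avoiding_least)
    fix u y assume "u \<in> insert w ?D" "y \<in> set (A u)" "y \<notin> M"
    then show "y \<in> insert w ?D"
      using avoiding_step[of u A "insert w M" _ y] avoiding_base[of y "set (A w) - insert w M"] by blast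
  qed simp
  have "?D \<subseteq> avoiding A M (set (A w) - insert w M)" by (rule avoiding_mono) auto
  also have "\<dots> \<subseteq> avoiding A M {w}"
    by (rule avoiding_trans) (auto intro: avoiding_step avoiding_base)
  finally show "insert w ?D \<subseteq> avoiding A M {w}" by (auto intro: avoiding_base)
qed

definition outer :: "'a set \<Rightarrow> 'a \<Rightarrow> 'a set" where
  "outer M d = {x \<in> M. \<exists>e \<in> avoiding A M {d}. x \<in> set (A e)}"

definition Sep :: "'a \<Rightarrow> 'a set" where
  "Sep w = {x \<in> avoiding A {} I. x \<noteq> w \<and> x \<notin> avoiding A {w} I}"

lemma outer_split:
  assumes w: "w \<in> V" "w \<notin> M" and d: "d \<in> V" "d \<notin> M" "d \<notin> avoiding A M {w}"
  shows "outer (M \<union> avoiding A M {w}) d = outer M d"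
proof -
  let ?K = "avoiding A M {w}"
  have dis: "avoiding A M {d} \<inter> ?K = {}"
  proof (rule ccontr)
    assume "\<not> ?thesis"
    then obtain e where e: "e \<in> avoiding A M {d}" "e \<in> ?K" by blast
    then show False using avoiding_eq[OF e(1) d(1,2)] avoiding_eq[OF e(2) w] d(3)
        avoiding_base[of d "{d}" A M] by blast
  qed
  have "avoiding A M {d} \<subseteq> avoiding A (M \<union> ?K) {d}"
  proof
    fix x assume "x \<in> avoiding A M {d}"
    then show "x \<in> avoiding A (M \<union> ?K) {d}"
    proof (induction rule: avoiding_induct)
      case (base b)
      then show ?case by (rule avoiding_base)
    next
      case (step u y)
      then have "y \<notin> ?K" using dis avoiding_step[of u A M "{d}" y] by blast
      with step show ?case by (auto intro: avoiding_step)
    qed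
  qed
  moreover have "avoiding A (M \<union> ?K) {d} \<subseteq> avoiding A M {d}" by (rule avoiding_mono) auto
  ultimately have eq: "avoiding A (M \<union> ?K) {d} = avoiding A M {d}" by blast
  have "x \<notin> ?K" if "e \<in> avoiding A M {d}" "x \<in> set (A e)" for e x
  proof
    assume x: "x \<in> ?K"
    have "e \<in> V" "e \<notin> M" using that(1) avoiding_V[of "{d}" M] avoiding_disjoint[of "{d}" M A] d by auto
    then have "e \<in> ?K" using x that(2) sym[of e x] avoiding_step[of x A M "{w}" e] by blast
    then show False using dis that(1) by blast
  qed
  then show ?thesis unfolding outer_def eq by blast
qed

lemma Sep_eq:
  assumes w: "w \<in> V" "w \<notin> M" "w \<in> avoiding A {} I" and M: "I \<subseteq> M" "M \<subseteq> V" "M \<subseteq> avoiding A (- M) I"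
  defines "D \<equiv> avoiding A (insert w M) (set (A w) - insert w M)"
  shows "Sep w = {d \<in> D. outer (insert w M) d \<subseteq> {w}}"
proof -
  let ?M = "insert w M"
  have MR: "M \<subseteq> avoiding A {w} I" using M(3) avoiding_mono[of "{w}" "- M" I I A] w(2) by blast
  have DV: "D \<subseteq> V" "D \<inter> ?M = {}" "D \<subseteq> avoiding A {} I"
  proof -
    show "D \<subseteq> V" unfolding D_def by (rule avoiding_V) (use w(1) closed in blast)
    show "D \<inter> ?M = {}" unfolding D_def by (rule avoiding_disjoint) blast
    have "D \<subseteq> avoiding A {} (set (A w))" unfolding D_def by (rule avoiding_mono) auto
    also have "\<dots> \<subseteq> avoiding A {} I" by (rule avoiding_trans) (use w(3) in \<open>auto intro: avoiding_step\<close>)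
    finally show "D \<subseteq> avoiding A {} I" .
  qed
  have R: "avoiding A {} I \<subseteq> insert w (avoiding A {w} I \<union> D)"
  proof (rule avoiding_least)
    show "I \<subseteq> insert w (avoiding A {w} I \<union> D)" by (auto intro: avoiding_base)
    fix u y assume u: "u \<in> insert w (avoiding A {w} I \<union> D)" and y: "y \<in> set (A u)"
    show "y \<in> insert w (avoiding A {w} I \<union> D)"
    proof (cases "y \<in> ?M")
      case True
      then show ?thesis using MR by blast
    next
      case False
      then have "u \<in> D \<Longrightarrow> y \<in> D" "u = w \<Longrightarrow> y \<in> D"
        using y unfolding D_def by (auto intro: avoiding_step avoiding_base)
      then show ?thesis using u y False avoiding_step[of u A "{w}" I y] by blast
    qed
  qed
  show ?thesis
  proof (intro equalityI subsetI)
    fix x assume "x \<in> Sep w"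
    then have x: "x \<in> avoiding A {} I" "x \<noteq> w" "x \<notin> avoiding A {w} I" by (auto simp: Sep_def)
    with R have xD: "x \<in> D" by blast
    have "y = w" if "y \<in> outer ?M x" for y
    proof (rule ccontr)
      assume "y \<noteq> w"
      with that obtain e where y: "y \<in> M" and e: "e \<in> avoiding A ?M {x}" "y \<in> set (A e)"
        unfolding outer_def by blast
      have eV: "e \<in> V" "e \<notin> ?M"
        using e(1) avoiding_V[of "{x}" ?M] avoiding_disjoint[of "{x}" ?M A] xD DV by blast+
      have "e \<in> avoiding A {w} I"
        using eV y MR sym[OF eV(1) e(2)] avoiding_step[of y A "{w}" I e] by blast
      moreover have "x \<in> avoiding A ?M {e}" using avoiding_sym[OF e(1)] xD DV by blast
      ultimately have "x \<in> avoiding A {w} I"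
        using avoiding_mono[of "{w}" ?M "{e}" "{e}" A] avoiding_trans[of "{e}" A "{w}" I] by blast
      then show False using x by blast
    qed
    then show "x \<in> {d \<in> D. outer ?M d \<subseteq> {w}}" using xD by blast
  next
    fix d assume "d \<in> {d \<in> D. outer ?M d \<subseteq> {w}}"
    then have d: "d \<in> D" "outer ?M d \<subseteq> {w}" by auto
    let ?K = "avoiding A ?M {d}"
    have KV: "?K \<inter> ?M = {}" by (rule avoiding_disjoint) (use d DV in blast)
    have "avoiding A {w} I \<subseteq> V - ?K - {w}"
    proof (rule avoiding_least)
      show "I \<subseteq> V - ?K - {w}" using KV M w by blast
      fix u y assume u: "u \<in> V - ?K - {w}" and y: "y \<in> set (A u)" "y \<notin> {w}"
      have "y \<notin> ?K"
      proof
        assume yK: "y \<in> ?K"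
        have uy: "u \<in> set (A y)" using u y sym by blast
        show False
        proof (cases "u \<in> ?M")
          case True
          then have "u \<in> outer ?M d" unfolding outer_def using yK uy by blast
          then show False using d u by blast
        next
          case False
          then show False using avoiding_step[OF yK uy] u by blast
        qed
      qed
      then show "y \<in> V - ?K - {w}" using u y closed by blast
    qed
    then have "d \<notin> avoiding A {w} I" using avoiding_base[of d "{d}" A ?M] by blast
    then show "d \<in> Sep w" unfolding Sep_def using d DV by blast
  qed
qed


definition dfs_pre :: "'a set \<Rightarrow> 'a \<Rightarrow> 'a list \<Rightarrow> 'a dfs_state \<Rightarrow> bool" where
  "dfs_pre M p ws st = (case st of (num, c, sep) \<Rightarrow>
     dom num = M \<and> M \<subseteq> V \<and> I \<subseteq> M \<and> p \<in> M \<and> set ws \<subseteq> set (A p) \<and>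
     (\<forall>x \<in> M. the (num x) < c) \<and>
     (p \<notin> I \<longrightarrow> (\<forall>x \<in> M - {p}. \<forall>y \<in> set (A x) - M. the (num x) < the (num p))) \<and>
     M \<subseteq> avoiding A (- M) I \<and> (\<forall>d. d \<notin> M \<longrightarrow> sep d = 0))"

definition dfs_post ::
  "'a set \<Rightarrow> 'a \<Rightarrow> nat \<Rightarrow> 'a list \<Rightarrow> 'a dfs_state \<Rightarrow> 'a set \<Rightarrow> 'a dfs_state \<Rightarrow> nat \<Rightarrow> bool" where
  "dfs_post M p low ws st D st' low' = (case st of (num, c, sep) \<Rightarrow> case st' of (num', c', sep') \<Rightarrow>
     dom num' = M \<union> D \<and> (\<forall>x \<in> M. num' x = num x) \<and> c \<le> c' \<and>
     (\<forall>x \<in> M \<union> D. the (num' x) < c') \<and> (\<forall>x \<in> D. c \<le> the (num' x)) \<and>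
     (\<forall>b \<le> c. b \<le> low' \<longleftrightarrow> b \<le> low \<and>
        (\<forall>x \<in> M. (x \<in> set ws \<or> (\<exists>d \<in> D. x \<in> set (A d))) \<longrightarrow> b \<le> the (num x))) \<and>
     (\<forall>x \<in> M - {p}. sep' x = sep x) \<and> (\<forall>d \<in> D. sep' d = card (Sep d)) \<and>
     (p \<notin> I \<longrightarrow> sep' p = sep p + card {d \<in> D. outer M d \<subseteq> {p}}) \<and>
     (\<forall>d. d \<notin> M \<union> D \<longrightarrow> sep' d = 0))"

lemma dfs_post_sep:
  "dfs_post M p low ws (num, c, sep) D (num', c', sep') low' \<Longrightarrow> p \<notin> I \<Longrightarrow>
    sep' p = sep p + card {d \<in> D. outer M d \<subseteq> {p}}"
  unfolding dfs_post_def prod.case by simp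

lemma dfs_post_low:
  "dfs_post M p low ws (num, c, sep) D (num', c', sep') low' \<Longrightarrow> b \<le> c \<Longrightarrow>
    b \<le> low' \<longleftrightarrow> b \<le> low \<and>
      (\<forall>x \<in> M. (x \<in> set ws \<or> (\<exists>d \<in> D. x \<in> set (A d))) \<longrightarrow> b \<le> the (num x))"
  unfolding dfs_post_def prod.case by simp

lemma reach_extend:
  assumes "M \<subseteq> avoiding A (- M) I" "N \<subseteq> avoiding A M B" "N \<inter> M = {}"
    "avoiding A M B \<subseteq> N" "\<And>b. b \<in> B \<Longrightarrow> \<exists>p \<in> M. b \<in> set (A p)"
  shows "M \<union> N \<subseteq> avoiding A (- (M \<union> N)) I"
proof -
  have 1: "M \<subseteq> avoiding A (- (M \<union> N)) I"
    using assms(1) avoiding_mono[of "- (M \<union> N)" "- M" I I A] by blast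
  have "x \<in> avoiding A (- (M \<union> N)) I" if "x \<in> avoiding A M B" for x
    using that
  proof (induction rule: avoiding_induct)
    case (base b)
    then obtain p where p: "p \<in> M" "b \<in> set (A p)" using assms(5) by blast
    then show ?case using 1 assms(4) avoiding_base[OF base, of A M]
        avoiding_step[of p A "- (M \<union> N)" I b] by blast
  next
    case (step u y)
    then have "y \<in> avoiding A M B" by (auto intro: avoiding_step)
    then show ?case using step assms(4) avoiding_step[of u A "- (M \<union> N)" I y] by blast
  qed
  with 1 assms show ?thesis by blast
qed

lemma dfs_correct:
  assumes "dfs_pre M p ws st"
  shows "\<exists>st' low' t. dfs A p low sz ws st = Some ((st', low', sz + card (avoiding A M (set ws - M))), t) \<and>
    dfs_post M p low ws st (avoiding A M (set ws - M)) st' low'"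
  using assms
proof (induction "(card (V - M), length ws)" arbitrary: M p low sz ws st
    rule: wf_induct_rule[OF wf_lex_prod[OF wf_less_than wf_less_than]])
  case (1 M ws p low sz st)
  obtain num c sep where st: "st = (num, c, sep)" by (cases st)
  note pre = 1(2)[unfolded st dfs_pre_def prod.case]
  from pre have domM: "dom num = M" and MV: "M \<subseteq> V" and IM: "I \<subseteq> M" and pM: "p \<in> M"
    and wsA: "set ws \<subseteq> set (A p)" and numc: "\<forall>x \<in> M. the (num x) < c"
    and act: "p \<notin> I \<longrightarrow> (\<forall>x \<in> M - {p}. \<forall>y \<in> set (A x) - M. the (num x) < the (num p))"
    and reach: "M \<subseteq> avoiding A (- M) I" and sep0: "\<forall>d. d \<notin> M \<longrightarrow> sep d = 0" by auto
  show ?case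
  proof (cases ws)
    case Nil
    have e: "avoiding A M {} = {}" by (simp add: avoiding_def)
    show ?thesis unfolding st Nil
      by (subst dfs.simps) (use domM numc sep0 in \<open>auto simp: e ret_def dfs_post_def\<close>)
  next
    case (Cons w ws')
    let ?D = "avoiding A M (set ws - M)"
    show ?thesis
    proof (cases "num w")
      case (Some i)
      then have wM: "w \<in> M" using domM by blast
      have eq: "set ws - M = set ws' - M" using Cons wM by auto
      have "\<exists>st' low' t. dfs A p (min low i) sz ws' st = Some ((st', low', sz + card (avoiding A M (set ws' - M))), t) \<and>
        dfs_post M p (min low i) ws' st (avoiding A M (set ws' - M)) st' low'"
        by (rule 1(1)) (use 1(2) Cons in \<open>auto simp: dfs_pre_def\<close>)
      then obtain st' low' t where d: "dfs A p (min low i) sz ws' st = Some ((st', low', sz + card ?D), t)"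
        and post: "dfs_post M p (min low i) ws' st ?D st' low'" unfolding eq by blast
      have "dfs_post M p low ws st ?D st' low'"
        using post wM Some unfolding dfs_post_def st prod.case Cons by (auto split: prod.splits)
      moreover have "dfs A p low sz ws st = Some ((st', low', sz + card ?D), Suc t)"
        using d Some unfolding st Cons by (subst dfs.simps) simp
      ultimately show ?thesis by blast
    next
      case None
      then have wM: "w \<notin> M" using domM by blast
      have wp: "w \<in> set (A p)" using wsA Cons by simp
      have pV: "p \<in> V" using pM MV by blast
      have wV: "w \<in> V" using closed[OF pV wp] .
      let ?M1 = "insert w M" and ?K = "avoiding A M {w}"
      let ?D1 = "avoiding A ?M1 (set (A w) - ?M1)"
      have K: "?K = insert w ?D1" using avoiding_insert[OF wM] .
      have KM: "?K \<inter> M = {}" using avoiding_disjoint[of "{w}" M A] wM by blast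
      have KV: "?K \<subseteq> V" using avoiding_V[of "{w}"] wV by blast
      have finK: "finite ?K" using KV fin finite_subset by blast
      have D1M: "?D1 \<inter> ?M1 = {}" by (rule avoiding_disjoint) blast
      have finD1: "finite ?D1" using finK K by simp
      have cK: "1 + card ?D1 = card ?K" using K D1M finD1 by simp
      have reach1: "?M1 \<subseteq> avoiding A (- ?M1) I"
      proof -
        have "M \<subseteq> avoiding A (- ?M1) I"
          using reach avoiding_mono[of "- ?M1" "- M" I I A] by blast
        then show ?thesis using avoiding_step[of p A "- ?M1" I w] pM wp by blast
      qed
      have "\<forall>x \<in> ?M1. the ((num(w \<mapsto> c)) x) < Suc c"
        using numc by (simp add: less_SucI)
      then have pre1: "dfs_pre ?M1 w (A w) (num(w \<mapsto> c), Suc c, sep)"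
        unfolding dfs_pre_def prod.case
        using domM MV wV IM numc reach1 sep0 wM by auto
      have card1: "card (V - ?M1) < card (V - M)"
        by (rule psubset_card_mono) (use fin wV wM in auto)
      have "\<exists>st' low' t. dfs A w c 1 (A w) (num(w \<mapsto> c), Suc c, sep) = Some ((st', low', 1 + card ?D1), t) \<and>
        dfs_post ?M1 w c (A w) (num(w \<mapsto> c), Suc c, sep) ?D1 st' low'"
        by (rule 1(1)) (use pre1 card1 in auto)
      then obtain num1 c1 sep1 l t1
        where d1: "dfs A w c 1 (A w) (num(w \<mapsto> c), Suc c, sep) = Some (((num1, c1, sep1), l, card ?K), t1)"
        and post1: "dfs_post ?M1 w c (A w) (num(w \<mapsto> c), Suc c, sep) ?D1 (num1, c1, sep1) l"
        unfolding cK by auto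
      note post1' = post1[unfolded dfs_post_def prod.case]
      have dom1: "dom num1 = M \<union> ?K" using post1' K by auto
      have num1M: "\<forall>x \<in> M. num1 x = num x" using post1' wM by auto
      have num1w: "num1 w = Some c" using post1' by auto
      have c1: "Suc c \<le> c1" "\<forall>x \<in> M \<union> ?K. the (num1 x) < c1" using post1' K by auto
      have num1K: "\<forall>x \<in> ?K. c \<le> the (num1 x)" using post1' K num1w by fastforce
      have low1: "b \<le> l \<longleftrightarrow> (\<forall>x \<in> outer M w. b \<le> the (num x))" if "b \<le> c" for b
      proof -
        have "b \<le> l \<longleftrightarrow> b \<le> c \<and> (\<forall>x \<in> ?M1. (x \<in> set (A w) \<or> (\<exists>d \<in> ?D1. x \<in> set (A d))) \<longrightarrow>
            b \<le> the ((num(w \<mapsto> c)) x))"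
          using post1' that by auto
        also have "\<dots> \<longleftrightarrow> (\<forall>x \<in> outer M w. b \<le> the (num x))"
          unfolding outer_def K using that wM by auto
        finally show ?thesis .
      qed
      have wR: "w \<in> avoiding A {} I"
        using reach1 avoiding_mono[of "{}" "- ?M1" I I A] by blast
      have sep1w: "sep1 w = card (Sep w)"
        using post1' wM IM sep0 Sep_eq[OF wV wM wR IM MV reach] by auto
      have sep1K: "\<forall>d \<in> ?K. sep1 d = card (Sep d)" using post1' sep1w K by auto
      have sep1M: "\<forall>x \<in> M. sep1 x = sep x" using post1' wM by auto
      have sep10: "\<forall>d. d \<notin> M \<union> ?K \<longrightarrow> sep1 d = 0" using post1' K by auto
      have pout: "p \<in> outer M w"
        unfolding outer_def using pM sym[OF pV wp] avoiding_base[of w "{w}" A M] by blast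
      have crit: "the (num1 p) \<le> l \<longleftrightarrow> outer M w \<subseteq> {p}" if pI: "p \<notin> I"
      proof -
        have "the (num1 p) \<le> l \<longleftrightarrow> (\<forall>x \<in> outer M w. the (num p) \<le> the (num x))"
          using low1[of "the (num p)"] numc pM num1M by (simp add: less_imp_le)
        also have "\<dots> \<longleftrightarrow> outer M w \<subseteq> {p}"
        proof -
          have "the (num x) < the (num p)" if x: "x \<in> outer M w" "x \<noteq> p" for x
          proof -
            from x obtain e where e: "x \<in> M" "e \<in> ?K" "x \<in> set (A e)" unfolding outer_def by blast
            then have "e \<in> set (A x) - M" using sym[of e x] KV KM by blast
            then show ?thesis using act pI e(1) x(2) by blast
          qed
          then show ?thesis by (fastforce simp: not_less[symmetric])
        qed
        finally show ?thesis .
      qed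
      let ?M2 = "M \<union> ?K"
      let ?D2 = "avoiding A ?M2 (set ws' - ?M2)"
      define sep2 where "sep2 = (if the (num1 p) \<le> l then sep1(p := sep1 p + card ?K) else sep1)"
      have pK: "p \<notin> ?K" using pM KM by blast
      have Kcl: "y \<in> M \<union> ?K" if "x \<in> ?K" "y \<in> set (A x)" for x y
        using that avoiding_step[of x A M "{w}" y] by blast
      have reach2: "?M2 \<subseteq> avoiding A (- ?M2) I"
        by (rule reach_extend[OF reach, where B = "{w}"]) (use KM wp pM in auto)
      have act2: "p \<notin> I \<longrightarrow> (\<forall>x \<in> ?M2 - {p}. \<forall>y \<in> set (A x) - ?M2. the (num1 x) < the (num1 p))"
      proof (intro impI ballI)
        fix x y assume "p \<notin> I" and x: "x \<in> ?M2 - {p}" and y: "y \<in> set (A x) - ?M2"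
        then have "x \<in> M" using Kcl by blast
        then show "the (num1 x) < the (num1 p)" using act \<open>p \<notin> I\<close> x y num1M pM by auto
      qed
      have sep20: "\<forall>d. d \<notin> ?M2 \<longrightarrow> sep2 d = 0" using sep10 pM by (auto simp: sep2_def)
      have pre2: "dfs_pre ?M2 p ws' (num1, c1, sep2)"
        unfolding dfs_pre_def prod.case
        using dom1 MV KV IM pM wsA Cons c1(2) act2 reach2 sep20 by auto
      have "w \<in> ?K" by (rule avoiding_base) simp
      then have card2: "card (V - ?M2) < card (V - M)"
        by (intro psubset_card_mono) (use fin wV wM in auto)
      have "\<exists>st' low' t. dfs A p (min low l) (sz + card ?K) ws' (num1, c1, sep2)
          = Some ((st', low', sz + card ?K + card ?D2), t) \<and>
        dfs_post ?M2 p (min low l) ws' (num1, c1, sep2) ?D2 st' low'"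
        by (rule 1(1)) (use pre2 card2 in auto)
      then obtain num2 c2 sep3 low2 t2
        where d2: "dfs A p (min low l) (sz + card ?K) ws' (num1, c1, sep2)
          = Some (((num2, c2, sep3), low2, sz + card ?K + card ?D2), t2)"
        and post2: "dfs_post ?M2 p (min low l) ws' (num1, c1, sep2) ?D2 (num2, c2, sep3) low2"
        by auto
      note post2' = post2[unfolded dfs_post_def prod.case]
      have D: "?D = ?K \<union> ?D2"
      proof
        show "?D \<subseteq> ?K \<union> ?D2"
        proof (rule avoiding_least)
          show "set ws - M \<subseteq> ?K \<union> ?D2"
            using avoiding_base[of _ "set ws' - ?M2" A ?M2] \<open>w \<in> ?K\<close> Cons by auto
          fix u y assume "u \<in> ?K \<union> ?D2" "y \<in> set (A u)" "y \<notin> M"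
          then show "y \<in> ?K \<union> ?D2" using Kcl avoiding_step[of u A ?M2 _ y] by blast
        qed
        have "?K \<subseteq> ?D" by (rule avoiding_mono) (use Cons wM in auto)
        moreover have "?D2 \<subseteq> ?D" by (rule avoiding_mono) (use Cons in auto)
        ultimately show "?K \<union> ?D2 \<subseteq> ?D" by blast
      qed
      have D2M: "?D2 \<inter> ?M2 = {}" by (rule avoiding_disjoint) blast
      have D2V: "?D2 \<subseteq> V" by (rule avoiding_V) (use wsA Cons pV closed in auto)
      have finD2: "finite ?D2" using D2V fin finite_subset by blast
      have cD: "card ?D = card ?K + card ?D2"
        unfolding D by (rule card_Un_disjoint) (use finK finD2 D2M in auto)
      have outK: "outer M d = outer M w" if "d \<in> ?K" for d
        unfolding outer_def using avoiding_eq[OF that wV wM] by simp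
      have outD2: "outer ?M2 d = outer M d" if "d \<in> ?D2" for d
        by (rule outer_split) (use that D2V D2M wV wM in auto)
      have run: "dfs A p low sz ws st = Some (((num2, c2, sep3), low2, sz + card ?D), Suc (t1 + t2))"
        unfolding st Cons cD[unfolded Cons]
        by (subst dfs.simps) (use None d1 d2 in \<open>simp add: andthen_def sep2_def add.assoc\<close>)
      have "dfs_post M p low ws st ?D (num2, c2, sep3) low2"
        unfolding dfs_post_def st prod.case
      proof (intro conjI)
        show "dom num2 = M \<union> ?D" using post2' D by auto
        show "\<forall>x \<in> M. num2 x = num x" using post2' num1M by auto
        show "c \<le> c2" using post2' c1 by auto
        show "\<forall>x \<in> M \<union> ?D. the (num2 x) < c2" using post2' D by auto
        show "\<forall>x \<in> ?D. c \<le> the (num2 x)" using post2' D num1K c1 by fastforce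
        show "\<forall>x \<in> M - {p}. sep3 x = sep x" using post2' sep1M by (auto simp: sep2_def)
        show "\<forall>d \<in> ?D. sep3 d = card (Sep d)"
        proof
          fix d assume "d \<in> ?D"
          then consider "d \<in> ?K" | "d \<in> ?D2" using D by blast
          then show "sep3 d = card (Sep d)"
          proof cases
            case 1
            then have "d \<noteq> p" using pK by blast
            then have "sep3 d = sep2 d" using post2' 1 by auto
            then show ?thesis using sep1K 1 \<open>d \<noteq> p\<close> by (simp add: sep2_def)
          next
            case 2
            then show ?thesis using post2' by auto
          qed
        qed
        show "\<forall>d. d \<notin> M \<union> ?D \<longrightarrow> sep3 d = 0" using post2' D by auto
        show "p \<notin> I \<longrightarrow> sep3 p = sep p + card {d \<in> ?D. outer M d \<subseteq> {p}}"
        proof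
          assume pI: "p \<notin> I"
          have split: "{d \<in> ?D. outer M d \<subseteq> {p}} =
              (if outer M w \<subseteq> {p} then ?K else {}) \<union> {d \<in> ?D2. outer ?M2 d \<subseteq> {p}}"
            unfolding D using outK outD2 by auto
          have 1: "card {d \<in> ?D. outer M d \<subseteq> {p}} =
            (if outer M w \<subseteq> {p} then card ?K else 0) + card {d \<in> ?D2. outer ?M2 d \<subseteq> {p}}"
            unfolding split by (subst card_Un_disjoint) (use finK finD2 D2M in auto)
          note 2 = dfs_post_sep[OF post2 pI]
          have "sep1 p = sep p" using sep1M pM by (rule bspec)
          then have 3: "sep2 p = sep p + (if outer M w \<subseteq> {p} then card ?K else 0)"
            unfolding sep2_def crit[OF pI] by simp
          show "sep3 p = sep p + card {d \<in> ?D. outer M d \<subseteq> {p}}" unfolding 1 2 3 by (rule add.assoc)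
        qed
        show "\<forall>b \<le> c. b \<le> low2 \<longleftrightarrow> b \<le> low \<and>
          (\<forall>x \<in> M. (x \<in> set ws \<or> (\<exists>d \<in> ?D. x \<in> set (A d))) \<longrightarrow> b \<le> the (num x))"
        proof (intro allI impI)
          fix b assume b: "b \<le> c"
          have "b \<le> low2 \<longleftrightarrow> b \<le> min low l \<and>
            (\<forall>x \<in> ?M2. (x \<in> set ws' \<or> (\<exists>d \<in> ?D2. x \<in> set (A d))) \<longrightarrow> b \<le> the (num1 x))"
            by (rule dfs_post_low[OF post2]) (use b c1 in simp)
          also have "\<dots> \<longleftrightarrow> b \<le> low \<and> (\<forall>x \<in> outer M w. b \<le> the (num x)) \<and>
            (\<forall>x \<in> M. (x \<in> set ws' \<or> (\<exists>d \<in> ?D2. x \<in> set (A d))) \<longrightarrow> b \<le> the (num x))"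
            using low1[OF b] num1K num1M b by (auto simp: ball_Un) 
          also have "\<dots> \<longleftrightarrow> b \<le> low \<and>
            (\<forall>x \<in> M. (x \<in> set ws \<or> (\<exists>d \<in> ?D. x \<in> set (A d))) \<longrightarrow> b \<le> the (num x))"
            unfolding D outer_def using wM Cons by auto
          finally show "b \<le> low2 \<longleftrightarrow> b \<le> low \<and>
            (\<forall>x \<in> M. (x \<in> set ws \<or> (\<exists>d \<in> ?D. x \<in> set (A d))) \<longrightarrow> b \<le> the (num x))" .
        qed
      qed
      with run show ?thesis by blast
    qed
  qed
qed


lemma dfs_roots_correct:
  assumes "dom num = M" "M \<subseteq> V" "I \<subseteq> M" "set qs \<subseteq> I" "\<forall>x \<in> M. the (num x) < c"
    "M \<subseteq> avoiding A (- M) I" "\<forall>d. d \<notin> M \<longrightarrow> sep d = 0" "\<forall>d \<in> M - I. sep d = card (Sep d)"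
    "\<forall>x \<in> M - set qs. set (A x) \<subseteq> M" "n + length qs = card M"
  shows "\<exists>num' c' sep' t. dfs_roots A qs n (num, c, sep) = Some (((num', c', sep'), card (avoiding A {} I)), t) \<and>
    (\<forall>d \<in> avoiding A {} I - I. sep' d = card (Sep d))"
  using assms
proof (induction qs arbitrary: num c sep M n)
  case Nil
  have "avoiding A {} I \<subseteq> M" by (rule avoiding_least) (use Nil in auto)
  moreover have "M \<subseteq> avoiding A {} I" using Nil(6) avoiding_mono[of "{}" "- M" I I A] by blast
  ultimately have "M = avoiding A {} I" by blast
  then show ?case using Nil by (auto simp: ret_def)
next
  case (Cons q qs)
  have qI: "q \<in> I" using Cons.prems by simp
  let ?D = "avoiding A M (set (A q) - M)"
  have "dfs_pre M q (A q) (num, c, sep)"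
    unfolding dfs_pre_def prod.case using Cons.prems qI by auto
  from dfs_correct[OF this, of 0 1] obtain num1 c1 sep1 l t1 where
    d: "dfs A q 0 1 (A q) (num, c, sep) = Some (((num1, c1, sep1), l, 1 + card ?D), t1)"
    and post: "dfs_post M q 0 (A q) (num, c, sep) ?D (num1, c1, sep1) l" by auto
  note post' = post[unfolded dfs_post_def prod.case]
  have DM: "?D \<inter> M = {}" by (rule avoiding_disjoint) blast
  have DV: "?D \<subseteq> V" by (rule avoiding_V) (use qI I closed in blast)
  have DI: "?D \<inter> I = {}" using DM Cons.prems by blast
  have cD: "card (M \<union> ?D) = card M + card ?D"
    by (rule card_Un_disjoint) (use DM DV Cons.prems(2) fin finite_subset in auto)
  have "\<exists>num' c' sep' t. dfs_roots A qs (n + (1 + card ?D)) (num1, c1, sep1)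
      = Some (((num', c', sep'), card (avoiding A {} I)), t) \<and>
    (\<forall>d \<in> avoiding A {} I - I. sep' d = card (Sep d))"
  proof (rule Cons.IH)
    show "dom num1 = M \<union> ?D" using post' by blast
    show "M \<union> ?D \<subseteq> V" using DV Cons.prems by blast
    show "I \<subseteq> M \<union> ?D" using Cons.prems by blast
    show "set qs \<subseteq> I" using Cons.prems by simp
    show "\<forall>x \<in> M \<union> ?D. the (num1 x) < c1" using post' by blast
    show "M \<union> ?D \<subseteq> avoiding A (- (M \<union> ?D)) I"
      by (rule reach_extend[OF Cons.prems(6), where B = "set (A q) - M"])
        (use DM qI Cons.prems in auto)
    show "\<forall>d. d \<notin> M \<union> ?D \<longrightarrow> sep1 d = 0" using post' by blast
    show "\<forall>d \<in> M \<union> ?D - I. sep1 d = card (Sep d)"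
    proof
      fix d assume d: "d \<in> M \<union> ?D - I"
      show "sep1 d = card (Sep d)"
      proof (cases "d \<in> ?D")
        case True
        then show ?thesis using post' by blast
      next
        case False
        then have "d \<in> M - {q}" "d \<in> M - I" using d qI by auto
        then show ?thesis using post' Cons.prems(8) by metis
      qed
    qed
    show "\<forall>x \<in> M \<union> ?D - set qs. set (A x) \<subseteq> M \<union> ?D"
    proof (intro ballI subsetI)
      fix x y assume x: "x \<in> M \<union> ?D - set qs" and y: "y \<in> set (A x)"
      show "y \<in> M \<union> ?D"
      proof (cases "x \<in> M \<and> x \<noteq> q")
        case True
        then show ?thesis using Cons.prems(9) x y by auto
      next
        case False
        then consider "x = q" | "x \<in> ?D" using x by blast
        then show ?thesis
          by cases (use y in \<open>auto intro: avoiding_base avoiding_step\<close>)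
      qed
    qed
    show "n + (1 + card ?D) + length qs = card (M \<union> ?D)" using Cons.prems(10) cD by simp
  qed
  then show ?case using d by (auto simp: andthen_def)
qed

lemma card_avoiding:
  assumes "v \<in> avoiding A {} I" "v \<notin> I"
  shows "card (avoiding A {v} I) = card (avoiding A {} I) - Suc (card (Sep v))"
proof -
  let ?R = "avoiding A {} I"
  have sub: "avoiding A {v} I \<subseteq> ?R" by (rule avoiding_mono) auto
  have v: "v \<notin> avoiding A {v} I" using avoiding_disjoint[of I "{v}" A] assms by blast
  have "avoiding A {v} I = ?R - insert v (Sep v)" unfolding Sep_def using sub v by blast
  moreover have "insert v (Sep v) \<subseteq> ?R" "v \<notin> Sep v" using assms unfolding Sep_def by auto
  moreover have "finite ?R" using avoiding_V[OF I] fin finite_subset by blast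
  ultimately show ?thesis by (metis card_Diff_subset card_insert_disjoint finite_insert finite_subset)
qed

lemma all_mandatory_avoiding:
  assumes "distinct In" "set In = I"
  shows "\<exists>mand t. all_mandatory A In k = Some (mand, t) \<and>
    (\<forall>v \<in> avoiding A {} I - I. mand v \<longleftrightarrow> card (avoiding A {v} I) \<le> k - 1)"
proof -
  let ?num = "\<lambda>v. if v \<in> set In then Some (0::nat) else None"
  have "\<exists>num' c' sep' t. dfs_roots A In 0 (?num, 1, \<lambda>_. 0) = Some (((num', c', sep'), card (avoiding A {} I)), t) \<and>
    (\<forall>d \<in> avoiding A {} I - I. sep' d = card (Sep d))"
    by (rule dfs_roots_correct[where M = I])
      (use assms I in \<open>auto simp: dom_def distinct_card intro: avoiding_base\<close>)
  then show ?thesis using card_avoiding by (auto simp: all_mandatory_def andthen_def ret_def)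
qed

end

lemma (in graph) adj_graph:
  assumes "adjacency_lists G A" "S \<subseteq> verts G"
  shows "adj_graph A (verts G) S"
proof
  fix u w assume "u \<in> verts G" "w \<in> set (A u)"
  then have uw: "u \<rightarrow> w" using assms by (auto simp: adjacency_lists_def)
  then show w: "w \<in> verts G" by (rule adj_in_verts)
  from uw have "w \<rightarrow> u" using sym_arcs by (auto simp: symmetric_def dest: symD)
  then show "u \<in> set (A w)" using assms(1) w by (auto simp: adjacency_lists_def)
qed (use assms in auto)

lemma (in graph) component_without_avoiding:
  assumes "adjacency_lists G A" "S \<subseteq> verts G" "v \<notin> S"
  shows "component_without G v S = avoiding A {v} S"
proof -
  have dom: "x \<rightarrow>\<^bsub>del_vert v\<^esub> y \<longleftrightarrow> x \<rightarrow> y \<and> x \<noteq> v \<and> y \<noteq> v" for x y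
    unfolding arcs_ends_def arc_to_ends_def del_vert_def by fastforce
  have verts: "verts (del_vert v) = verts G - {v}" by (simp add: del_vert_def)
  have A: "w \<in> set (A u) \<longleftrightarrow> u \<rightarrow> w" if "u \<in> verts G" for u w
    using assms(1) that by (auto simp: adjacency_lists_def)
  have 1: "w \<in> avoiding A {v} S" if "u \<in> S" "u \<rightarrow>\<^sup>*\<^bsub>del_vert v\<^esub> w" for u w
    using that(2) unfolding reachable_def
  proof (induction rule: rtrancl_on_induct)
    case base
    show ?case using that(1) by (rule avoiding_base)
  next
    case (step y z)
    have "z \<in> set (A y)" "z \<notin> {v}" using step(2,3) A[of y z] dom[of y z] verts by simp_all
    with step(5) show ?case by (rule avoiding_step)
  qed
  have 2: "\<exists>u \<in> S. u \<rightarrow>\<^sup>*\<^bsub>del_vert v\<^esub> w" if "w \<in> avoiding A {v} S" for w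
    using that
  proof (induction rule: avoiding_induct)
    case (base b)
    then have "b \<in> verts (del_vert v)" using assms(2,3) verts by blast
    then have "b \<rightarrow>\<^sup>*\<^bsub>del_vert v\<^esub> b" unfolding reachable_def by (rule rtrancl_on_refl)
    with base show ?case by blast
  next
    case (step x y)
    then obtain u where u: "u \<in> S" "u \<rightarrow>\<^sup>*\<^bsub>del_vert v\<^esub> x" by blast
    from u(2) have x: "x \<in> verts G" "x \<noteq> v" using verts by (auto elim: reachable_in_vertsE)
    have y: "y \<in> set (A x)" "y \<noteq> v" using step by simp_all
    have xy: "x \<rightarrow> y" using A[OF x(1)] y(1) by simp
    have "y \<in> verts G" using xy by (rule adj_in_verts)
    then have "y \<in> verts (del_vert v)" using y(2) unfolding verts by simp
    moreover have "x \<rightarrow>\<^bsub>del_vert v\<^esub> y" unfolding dom using xy x(2) y(2) by simp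
    ultimately have "u \<rightarrow>\<^sup>*\<^bsub>del_vert v\<^esub> y"
      using u(2) unfolding reachable_def by (metis rtrancl_on_into_rtrancl_on)
    then show ?case using u(1) by blast
  qed
  show ?thesis unfolding component_without_def using 1 2 by blast
qed

lemma (in graph) is_mandatory_correct:
  assumes "adjacency_lists G A" "distinct In" "set In \<subseteq> verts G" "v \<notin> set In" "length In < k"
  shows "\<exists>t. is_mandatory A In k v = Some (mandatory G (set In) k v, t)"
proof -
  interpret adj_graph A "verts G" "set In" using assms by (intro adj_graph)
  have "finite (avoiding A {v} (set In))"
    using avoiding_V[OF I] fin finite_subset by blast
  then have "\<exists>t. bfs A k v In In [] = Some (card (avoiding A {v} (set In)) \<le> k - 1, t)"
    using assms by (intro bfs_correct) (auto intro: avoiding_base)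
  then show ?thesis
    using component_without_avoiding[OF assms(1,3,4)] by (auto simp: is_mandatory_def mandatory_def)
qed

lemma (in graph) all_mandatory_correct:
  assumes "adjacency_lists G A" "distinct In" "set In \<subseteq> verts G"
  shows "\<exists>mand t. all_mandatory A In k = Some (mand, t) \<and>
    (\<forall>u \<in> set In. \<forall>v. u \<rightarrow>\<^sup>* v \<and> v \<notin> set In \<longrightarrow> (mand v \<longleftrightarrow> mandatory G (set In) k v))"
proof -
  interpret adj_graph A "verts G" "set In" using assms by (intro adj_graph)
  from all_mandatory_avoiding[OF assms(2) refl, of k] obtain mand t where
    1: "all_mandatory A In k = Some (mand, t)" and
    2: "\<forall>v \<in> avoiding A {} (set In) - set In. mand v \<longleftrightarrow> card (avoiding A {v} (set In)) \<le> k - 1"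
    by (elim exE conjE)
  have "v \<in> avoiding A {} (set In)" if "u \<in> set In" "u \<rightarrow>\<^sup>* v" for u v
    using that(2) unfolding reachable_def
  proof (induction rule: rtrancl_on_induct)
    case base
    show ?case using that(1) by (rule avoiding_base)
  next
    case (step y z)
    have "z \<in> set (A y)" using step(2,3) assms(1) by (simp add: adjacency_lists_def)
    with step(5) show ?case by (rule avoiding_step) simp
  qed
  then have "mand v \<longleftrightarrow> mandatory G (set In) k v" if "u \<in> set In" "u \<rightarrow>\<^sup>* v" "v \<notin> set In" for u v
    using 2 that component_without_avoiding[OF assms(1,3) that(3)] by (simp add: mandatory_def)
  with 1 show ?thesis by blast
qed

end

theory Submission
  imports Defs
begin

text \<open>
  A call on \<open>(G, In)\<close> with \<open>g\<close> solutions makes two recursive calls with at least one solution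
  each, whose solutions are disjoint sets of solutions of the original call. So the recursion tree has \<open>O(g)\<close>
  nodes, and it is enough that every node takes time \<open>O(k min {k, \<Delta>})\<close>.
  The loops and breadth-first searches of ENUM-V never read more than \<open>O(min {k, \<Delta>})\<close> entries of a list,
  because the entries are distinct and the search stops when it has seen enough new vertices. LIN-ENUM-V is only called
  if two vertices of \<open>N(In)\<close> are mandatory, and then the component of \<open>In\<close> has at most \<open>2 k\<close> vertices.
  The exception is the deletion of a vertex \<open>z\<close> of degree larger than \<open>k\<close>. Its cost is paid by the
  solutions that contain \<open>z\<close>, of which there are at least \<open>deg z - k\<close>.
\<close>

section \<open>Extensions of a set of vertices\<close>

text \<open>If \<open>B\<close> induces a connected subgraph then \<open>extensions A B k\<close> are the \<open>k\<close>-graphlets that contain \<open>B\<close>.\<close>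

definition grown :: "'a adj \<Rightarrow> 'a set \<Rightarrow> 'a set \<Rightarrow> bool" where
  "grown A B S \<longleftrightarrow> B \<subseteq> S \<and> S \<subseteq> avoiding A (- S) B"

definition extensions :: "'a adj \<Rightarrow> 'a set \<Rightarrow> nat \<Rightarrow> 'a set set" where
  "extensions A B k = {S. card S = k \<and> grown A B S}"

definition frontier :: "'a adj \<Rightarrow> 'a set \<Rightarrow> 'a set" where
  "frontier A B = {w. w \<notin> B \<and> (\<exists>q \<in> B. w \<in> set (A q))}"

lemma grown_refl: "grown A B B"
  by (auto simp: grown_def intro: avoiding_base)

lemma grown_trans:
  assumes "grown A B C" "grown A C D"
  shows "grown A B D"
proof -
  have "C \<subseteq> avoiding A (- D) B"
    using assms avoiding_mono[of "- D" "- C" B B A] by (auto simp: grown_def)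
  then have "avoiding A (- D) C \<subseteq> avoiding A (- D) B" by (rule avoiding_trans)
  then show ?thesis using assms by (auto simp: grown_def)
qed

lemma grown_insert:
  assumes "w \<in> frontier A B"
  shows "grown A B (insert w B)"
proof -
  from assms obtain q where "q \<in> B" "w \<in> set (A q)" by (auto simp: frontier_def)
  then have "w \<in> avoiding A (- insert w B) B" by (auto intro: avoiding_base avoiding_step)
  then show ?thesis by (auto simp: grown_def intro: avoiding_base)
qed

text \<open>All of \<open>C\<close> is reached from \<open>B\<close> without leaving
  \<open>C\<close>, hence without touching \<open>X\<close>. Consequently adding vertices to
  \<open>In\<close> in the loops changes neither the component of \<open>In\<close> nor which of the
  remaining vertices are mandatory.\<close>

lemma grown_avoiding:
  assumes "grown A B C" "X \<inter> C = {}"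
  shows "avoiding A X C = avoiding A X B"
proof
  have "C \<subseteq> avoiding A X B"
    using assms avoiding_mono[of X "- C" B B A] by (auto simp: grown_def)
  then show "avoiding A X C \<subseteq> avoiding A X B" by (rule avoiding_trans)
  show "avoiding A X B \<subseteq> avoiding A X C" using assms by (intro avoiding_mono) (auto simp: grown_def)
qed

lemma set_delete: "w \<in> set (delete z A u) \<longleftrightarrow> u \<noteq> z \<and> w \<noteq> z \<and> w \<in> set (A u)"
  by (auto simp: delete_def)

text \<open>Deletion becomes avoidance, so the test that finds \<open>z\<close> non-mandatory also
  establishes the size precondition of the recursive call on the graph without
  \<open>z\<close>.\<close>

lemma avoiding_delete:
  assumes "z \<notin> B"
  shows "avoiding (delete z A) X B = avoiding A (insert z X) B"
proof
  show "avoiding (delete z A) X B \<subseteq> avoiding A (insert z X) B"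
    by (rule avoiding_least) (auto simp: set_delete intro: avoiding_base avoiding_step)
  have "avoiding A (insert z X) B \<subseteq> avoiding (delete z A) X B - {z}"
  proof (rule avoiding_least)
    fix u w assume "u \<in> avoiding (delete z A) X B - {z}" "w \<in> set (A u)" "w \<notin> insert z X"
    then show "w \<in> avoiding (delete z A) X B - {z}"
      using avoiding_step[of u "delete z A" X B w] by (auto simp: set_delete)
  qed (use assms in \<open>auto intro: avoiding_base\<close>)
  then show "avoiding A (insert z X) B \<subseteq> avoiding (delete z A) X B" by blast
qed

text \<open>A search never enters what it avoids, so \<open>S\<close> misses \<open>z\<close>; this
  is what separates the solutions of the two recursive calls.\<close>

lemma grown_delete:
  assumes "z \<notin> B" "grown (delete z A) B S"
  shows "grown A B S" "z \<notin> S"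
proof -
  have S: "B \<subseteq> S" "S \<subseteq> avoiding A (insert z (- S)) B"
    using assms by (auto simp: grown_def avoiding_delete)
  show "z \<notin> S" using S avoiding_disjoint[of B "insert z (- S)" A] assms(1) by blast
  then have "insert z (- S) = - S" by blast
  then show "grown A B S" using S by (simp add: grown_def)
qed

lemma extensions_subset: "S \<in> extensions A B k \<Longrightarrow> S \<subseteq> avoiding A {} B"
  using avoiding_mono[of "{}" "- S" B B A] by (auto simp: extensions_def grown_def)

lemma finite_extensions: "finite (avoiding A {} B) \<Longrightarrow> finite (extensions A B k)"
  by (rule finite_subset[of _ "Pow (avoiding A {} B)"]) (blast dest: extensions_subset, simp)

lemma card_extensions_grown:
  assumes "finite (avoiding A {} B)" "grown A B C"
  shows "card (extensions A C k) \<le> card (extensions A B k)"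
  using grown_trans[OF assms(2)]
  by (intro card_mono finite_extensions[OF assms(1)]) (auto simp: extensions_def)

text \<open>The two families are told apart by whether they contain \<open>z\<close>. With both of
  them nonempty, this inequality bounds the size of the recursion tree.\<close>

lemma card_extensions_branch:
  assumes fin: "finite (avoiding A {} B)" and z: "z \<in> frontier A B"
  shows "card (extensions A (insert z B) k) + card (extensions (delete z A) B k)
    \<le> card (extensions A B k)"
proof -
  have zB: "z \<notin> B" using z by (simp add: frontier_def)
  let ?E = "extensions A (insert z B) k" and ?F = "extensions (delete z A) B k"
  have sub: "?E \<union> ?F \<subseteq> extensions A B k"
    using grown_trans[OF grown_insert[OF z]] grown_delete[OF zB] by (auto simp: extensions_def)
  then have "finite (?E \<union> ?F)" using finite_extensions[OF fin] finite_subset by blast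
  moreover have "?E \<inter> ?F = {}"
    using grown_delete[OF zB] by (auto simp: extensions_def grown_def)
  ultimately have "card ?E + card ?F = card (?E \<union> ?F)" by (simp add: card_Un_disjoint)
  also have "\<dots> \<le> card (extensions A B k)" using sub finite_extensions[OF fin] by (rule card_mono[rotated])
  finally show ?thesis .
qed

text \<open>Grow \<open>B\<close> by one vertex at a time: a set smaller than the component is not
  closed under adjacency, so its frontier is nonempty. This gives every call a solution of its
  own.\<close>

lemma extensions_nonempty:
  assumes fin: "finite (avoiding A {} B)" and "card B \<le> k" "k \<le> card (avoiding A {} B)"
  shows "extensions A B k \<noteq> {}"
proof -
  have finB: "finite B" using fin by (rule finite_subset[rotated]) (auto intro: avoiding_base)
  have "k \<le> card (avoiding A {} B) \<longrightarrow> (\<exists>S. finite S \<and> card S = k \<and> grown A B S)"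
    using assms(2)
  proof (induction k rule: dec_induct)
    case base
    then show ?case using finB grown_refl by blast
  next
    case (step n)
    show ?case
    proof
      assume n: "Suc n \<le> card (avoiding A {} B)"
      then obtain S where S: "finite S" "card S = n" "grown A B S" using step by auto
      have "\<not> avoiding A {} B \<subseteq> S" using n S card_mono[of S "avoiding A {} B"] by auto
      then obtain w where w: "w \<in> frontier A S"
        using avoiding_least[of B S A "{}"] S by (auto simp: frontier_def grown_def)
      have "grown A B (insert w S)" using S(3) grown_insert[OF w] by (rule grown_trans)
      moreover have "card (insert w S) = Suc n" using S w by (simp add: frontier_def)
      ultimately show "\<exists>S. finite S \<and> card S = Suc n \<and> grown A B S" using S by blast
    qed
  qed
  then show ?thesis using assms by (auto simp: extensions_def)
qed

lemma grown_star:
  assumes "z \<in> B" "T \<subseteq> set (A z)"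
  shows "grown A B (B \<union> T)"
proof -
  have "t \<in> avoiding A (- (B \<union> T)) B" if "t \<in> T" for t
    using avoiding_step[OF avoiding_base[OF assms(1)], of t A "- (B \<union> T)"] that assms by blast
  then show ?thesis by (auto simp: grown_def intro: avoiding_base)
qed

text \<open>A vertex of large degree lies in many extensions: fill up \<open>B\<close> to \<open>k - 1\<close> vertices with neighbours
  of \<open>z\<close>, and choose the last vertex freely among the remaining neighbours.\<close>

lemma degree_le_extensions:
  assumes fin: "finite (avoiding A {} B)" and "z \<in> B" "card B < k" "distinct (A z)"
  shows "length (A z) \<le> card (extensions A B k) + k"
proof (cases "k \<le> length (A z)")
  case True
  have finB: "finite B" using fin by (rule finite_subset[rotated]) (auto intro: avoiding_base)
  let ?D = "set (A z) - B"
  have d: "length (A z) - card B \<le> card ?D"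
    using diff_card_le_card_Diff[OF finB, of "set (A z)"] assms(4) by (simp add: distinct_card)
  then have "k - 1 - card B \<le> card ?D" using True by simp
  then obtain R where R: "R \<subseteq> ?D" "card R = k - 1 - card B" "finite R"
    by (rule obtain_subset_with_card_n)
  \<comment> \<open>The last vertex \<open>w\<close> can be recovered from the set, being its only
    element outside \<open>B \<union> R\<close>.\<close>
  have "inj_on (\<lambda>w. B \<union> insert w R) (?D - R)" by (auto simp: inj_on_def)
  then have "card (?D - R) = card ((\<lambda>w. B \<union> insert w R) ` (?D - R))" by (rule card_image[symmetric])
  also have "\<dots> \<le> card (extensions A B k)"
  proof (intro card_mono finite_extensions fin image_subsetI)
    fix w assume w: "w \<in> ?D - R"
    have "B \<inter> insert w R = {}" using w R by blast
    then have "card (B \<union> insert w R) = card B + card (insert w R)"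
      using finB R by (intro card_Un_disjoint) auto
    also have "\<dots> = k" using w R assms(3) by simp
    finally show "B \<union> insert w R \<in> extensions A B k"
      using grown_star[OF assms(2), of "insert w R" A] w R by (auto simp: extensions_def)
  qed
  also have "card (?D - R) = card ?D - card R" using R by (intro card_Diff_subset) auto
  finally show ?thesis using d R assms(3) by linarith
qed simp

section \<open>Extensions and reachability in terms of the graph\<close>

text \<open>Any two vertices of \<open>S\<close> are joined through \<open>v\<close>, because a walk
  from \<open>v\<close> inside \<open>S\<close> can be reversed in the symmetric closure. Inclusion
  suffices, as the number of extensions only has to be bounded from above by the number of
  graphlets.\<close>

lemma (in graph) extensions_graphlets:
  assumes A: "adjacency_lists G A" and v: "v \<in> verts G"
  shows "extensions A {v} k \<subseteq> graphlets_at G k v"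
proof
  fix S assume S: "S \<in> extensions A {v} k"
  interpret adj_graph A "verts G" "{v}" using A v by (intro adj_graph) auto
  have SV: "S \<subseteq> verts G" using extensions_subset[OF S] avoiding_V[of "{v}" "{}"] v by blast
  have vS: "v \<in> S" "S \<subseteq> avoiding A (- S) {v}" using S by (auto simp: extensions_def grown_def)
  let ?E = "(arcs_ends (G \<restriction> S))\<^sup>s"
  have edge: "(x, y) \<in> ?E" if "x \<in> S" "y \<in> S" "y \<in> set (A x)" for x y
  proof -
    have "x \<rightarrow> y" using A that SV by (auto simp: adjacency_lists_def)
    then have "(x, y) \<in> arcs_ends (G \<restriction> S)"
      using that unfolding arcs_ends_def by (auto simp: arc_to_ends_def)
    then show ?thesis by (auto simp: symcl_def)
  qed
  have reach: "x \<in> S \<and> (v, x) \<in> rtrancl_on S ?E" if "x \<in> avoiding A (- S) {v}" for x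
    using that
  proof (induction rule: avoiding_induct)
    case (base b)
    then show ?case using vS by auto
  next
    case (step u w)
    then have "w \<in> S" "(u, w) \<in> ?E" using edge by auto
    then show ?case using step by (metis rtrancl_on_into_rtrancl_on)
  qed
  have "connected (G \<restriction> S)"
    unfolding connected_conv
  proof (intro conjI ballI)
    show "verts (G \<restriction> S) \<noteq> {}" using vS by auto
    fix x y assume "x \<in> verts (G \<restriction> S)" "y \<in> verts (G \<restriction> S)"
    then have "(v, x) \<in> rtrancl_on S ?E" "(v, y) \<in> rtrancl_on S ?E" using vS reach by auto
    moreover have "Relation.sym ?E" by (auto simp: symcl_def sym_def)
    then have "Relation.sym (rtrancl_on S ?E)" by (rule rtrancl_on_sym)
    ultimately have "(x, v) \<in> rtrancl_on S ?E" "(v, y) \<in> rtrancl_on S ?E" by (auto dest: symD)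
    then show "(x, y) \<in> rtrancl_on (verts (G \<restriction> S)) ?E"
      unfolding induce_subgraph_verts by (rule rtrancl_on_trans)
  qed
  then show "S \<in> graphlets_at G k v"
    using S SV vS by (auto simp: graphlets_at_def extensions_def)
qed

lemma (in graph) avoiding_verts:
  assumes A: "adjacency_lists G A" and v: "v \<in> verts G" and con: "connected G"
  shows "avoiding A {} {v} = verts G"
proof
  interpret adj_graph A "verts G" "{v}" using A v by (intro adj_graph) auto
  show "avoiding A {} {v} \<subseteq> verts G" using avoiding_V[of "{v}" "{}"] v by blast
  show "verts G \<subseteq> avoiding A {} {v}"
  proof
    fix w assume w: "w \<in> verts G"
    have "strongly_connected G" using symmetric_connected_imp_strongly_connected sym_arcs con by blast
    then have "v \<rightarrow>\<^sup>* w" using v w by auto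
    then show "w \<in> avoiding A {} {v}" unfolding reachable_def
    proof (induction rule: rtrancl_on_induct)
      case base
      show ?case by (rule avoiding_base) simp
    next
      case (step y z)
      have "z \<in> set (A y)" using step(2,3) A by (simp add: adjacency_lists_def)
      with step(5) show ?case by (rule avoiding_step) simp
    qed
  qed
qed

section \<open>Searches that stop early\<close>

text \<open>\<open>V\<close> does not shrink when a vertex is deleted: the deleted vertex keeps an
  empty list. So the same \<open>V\<close> and \<open>\<Delta>\<close> serve all calls of the
  recursion.\<close>

locale bounded_lists =
  fixes A :: "'a adj" and V :: "'a set" and \<Delta> :: nat
  assumes finite_V: "finite V"
    and closed_V: "u \<in> V \<Longrightarrow> set (A u) \<subseteq> V"
    and sym_V: "u \<in> V \<Longrightarrow> w \<in> set (A u) \<Longrightarrow> u \<in> set (A w)"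
    and distinct_V: "u \<in> V \<Longrightarrow> distinct (A u)"
    and degree_V: "u \<in> V \<Longrightarrow> length (A u) \<le> \<Delta>"
begin

lemma adj_graph_V: "I \<subseteq> V \<Longrightarrow> adj_graph A V I"
  using finite_V closed_V sym_V by (unfold_locales) blast+

lemma avoiding_subset_V: "B \<subseteq> V \<Longrightarrow> avoiding A X B \<subseteq> V"
  using closed_V by (intro avoiding_least) blast+

lemma finite_avoiding: "B \<subseteq> V \<Longrightarrow> finite (avoiding A X B)"
  using avoiding_subset_V finite_V finite_subset by metis

lemma bounded_lists_delete: "bounded_lists (delete z A) V \<Delta>"
proof
  show "length (delete z A u) \<le> \<Delta>" if "u \<in> V" for u
    using order_trans[OF length_filter_le degree_V[OF that]]
    by (simp add: delete_def removeAll_filter_not_eq)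
  show "distinct (delete z A u)" if "u \<in> V" for u
    using distinct_V[OF that] by (simp add: delete_def distinct_removeAll)
  show "u \<in> set (delete z A w)" if "u \<in> V" "w \<in> set (delete z A u)" for u w
    using sym_V[of u w] that by (simp add: set_delete)
  show "set (delete z A u) \<subseteq> V" if "u \<in> V" for u
    using closed_V[OF that] by (auto simp: set_delete)
qed (rule finite_V)

end

text \<open>Bounds the number of entries of \<open>ws\<close> that are read if the search stops when it has seen \<open>n\<close> entries
  outside \<open>X\<close>.\<close>

definition read_bound :: "'a list \<Rightarrow> 'a set \<Rightarrow> nat \<Rightarrow> nat" where
  "read_bound ws X n = min (length ws) (card (set ws \<inter> X) + n)"

lemma read_bound_Nil [simp]: "read_bound [] X n = 0"
  by (simp add: read_bound_def)

lemma read_bound_old: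
  assumes "w \<in> X" "distinct (w # ws)"
  shows "read_bound (w # ws) X n = Suc (read_bound ws X n)"
  using assms by (simp add: read_bound_def)

text \<open>Recording \<open>w\<close> puts it into \<open>X\<close> and uses up one of the
  \<open>n\<close> new entries. Distinctness keeps \<open>w\<close> out of \<open>ws\<close>, so the
  number of old entries still ahead does not change.\<close>

lemma read_bound_new:
  assumes "w \<notin> X" "distinct (w # ws)"
  shows "read_bound (w # ws) X (Suc n) = Suc (read_bound ws (insert w X) n)"
  using assms by (simp add: read_bound_def)

lemma read_bound_pos: "0 < n \<Longrightarrow> 0 < read_bound (w # ws) X n"
  by (simp add: read_bound_def)

text \<open>The source of the minimum of \<open>k\<close> and \<open>\<Delta>\<close>: with
  \<open>X\<close> and \<open>n\<close> of total size \<open>O(k)\<close>, a list contributes no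
  more than its length and no more than \<open>O(k)\<close> entries.\<close>

lemma read_bound_le: "finite X \<Longrightarrow> read_bound ws X n \<le> min (length ws) (card X + n)"
  by (auto simp: read_bound_def min_def card_mono intro: order_trans add_right_mono)

lemma charge_eq_Some: "charge n m = Some (x, t) \<longleftrightarrow> (\<exists>t'. m = Some (x, t') \<and> t = n + t')"
  by (cases m) (auto simp: charge_def andthen_def)

lemma andthen_eq_Some:
  "m \<rhd> f = Some (y, t) \<longleftrightarrow> (\<exists>x t1 t2. m = Some (x, t1) \<and> f x = Some (y, t2) \<and> t = t1 + t2)"
  by (cases m; cases "f (fst (the m))") (auto simp: andthen_def)

section \<open>Time of the breadth-first search and of the loop of ENUM-V\<close>

context bounded_lists
begin

lemma read_bound_bfs:
  assumes "q \<in> V" "length S < k"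
  shows "read_bound (A q) (insert v (set S)) (k - length S) \<le> min \<Delta> (Suc k)"
proof -
  have "card (insert v (set S)) \<le> Suc (length S)"
    using card_length[of "v # S"] by simp
  then show ?thesis
    using read_bound_le[of "insert v (set S)" "A q" "k - length S"] degree_V[OF assms(1)] assms(2) by auto
qed

text \<open>A potential argument. The first summand pays for the unread part of the current list.
  Each vertex in the queue, and each of the at most \<open>k - 1 - length S\<close> vertices still
  to be enqueued, costs 1 for dequeuing and at most \<open>min \<Delta> (Suc k)\<close> for its
  list; the \<open>k\<close>th vertex found ends the search and is not enqueued.\<close>

lemma bfs_time:
  assumes "bfs A k v S Q ws = Some (b, t)" "length S < k" "set Q \<subseteq> V" "set ws \<subseteq> V" "distinct ws"
  shows "t \<le> read_bound ws (insert v (set S)) (k - length S)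
    + (length Q + (k - 1 - length S)) * Suc (min \<Delta> (Suc k))"
  using assms
proof (induction "(k - length S, length Q, length ws)" arbitrary: S Q ws t
    rule: wf_induct_rule[OF wf_lex_prod[OF wf_less_than wf_lex_prod[OF wf_less_than wf_less_than]]])
  case (1 S Q ws t)
  note IH = 1(1) and a = 1(3-6)
  note run = 1(2)[unfolded bfs.simps[of A k v S Q ws]]
  show ?case
  proof (cases ws)
    case Nil
    show ?thesis
    proof (cases Q)
      case Q: Nil
      then show ?thesis using run Nil by (simp add: ret_def)
    next
      case (Cons q Q')
      have q: "q \<in> V" using a Cons by simp
      obtain t' where t': "bfs A k v S Q' (A q) = Some (b, t')" "t = Suc t'"
        using run by (auto simp: Nil Cons charge_eq_Some)
      have "t' \<le> read_bound (A q) (insert v (set S)) (k - length S)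
          + (length Q' + (k - 1 - length S)) * Suc (min \<Delta> (Suc k))"
        by (rule IH) (use t' a Cons q closed_V distinct_V in auto)
      then show ?thesis using read_bound_bfs[OF q a(1), of v] t'
        by (simp add: Nil Cons del: min.bounded_iff)
    qed
  next
    case (Cons w ws')
    have dis: "distinct (w # ws')" using a Cons by simp
    consider (old) "w = v \<or> w \<in> set S" | (full) "\<not> (w = v \<or> w \<in> set S)" "Suc (length S) = k"
      | (new) "\<not> (w = v \<or> w \<in> set S)" "Suc (length S) \<noteq> k" by blast
    then show ?thesis
    proof cases
      case old
      obtain t' where t': "bfs A k v S Q ws' = Some (b, t')" "t = Suc t'"
        using run old by (auto simp: Cons charge_eq_Some)
      have "t' \<le> read_bound ws' (insert v (set S)) (k - length S)
          + (length Q + (k - 1 - length S)) * Suc (min \<Delta> (Suc k))"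
        by (rule IH) (use t' a Cons in auto)
      then show ?thesis using read_bound_old[OF _ dis] old t' by (simp add: Cons)
    next
      case full
      then have "t = 1" using run by (auto simp: Cons ret_def)
      then show ?thesis
        using read_bound_pos[of "k - length S" w ws' "insert v (set S)"] a(1) by (simp add: Cons)
    next
      case new
      obtain t' where t': "bfs A k v (w # S) (Q @ [w]) ws' = Some (b, t')" "t = Suc t'"
        using run new by (auto simp: Cons charge_eq_Some)
      have k: "Suc (length S) < k" using new a by simp
      have "t' \<le> read_bound ws' (insert v (set (w # S))) (k - length (w # S))
          + (length (Q @ [w]) + (k - 1 - length (w # S))) * Suc (min \<Delta> (Suc k))"
        by (rule IH) (use t' a Cons k in auto)
      moreover have "read_bound ws (insert v (set S)) (k - length S) =
          Suc (read_bound ws' (insert v (set (w # S))) (k - length (w # S)))"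
        using read_bound_new[OF _ dis, of "insert v (set S)" "k - Suc (length S)"] new k
        by (simp add: Cons insert_commute Suc_diff_Suc)
      \<comment> \<open>\<open>w\<close> passes from the vertices still to be found into the queue,
        which leaves the budget for lists unchanged.\<close>
      moreover have "length (Q @ [w]) + (k - 1 - length (w # S)) = length Q + (k - 1 - length S)"
        using k by simp
      ultimately show ?thesis using t'(2) by (simp only:)
    qed
  qed
qed

lemma is_mandatory_spec:
  assumes In: "distinct In" "set In \<subseteq> V" "length In < k" "v \<notin> set In"
  shows "\<exists>t. is_mandatory A In k v = Some (card (avoiding A {v} (set In)) \<le> k - 1, t) \<and>
    t \<le> k + k * Suc (min \<Delta> (Suc k))"
proof -
  obtain t where t: "bfs A k v In In [] = Some (card (avoiding A {v} (set In)) \<le> k - 1, t)"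
    using bfs_correct[of A v "set In" In k In "[]"] assms finite_avoiding[OF In(2)]
    by (auto intro: avoiding_base)
  from bfs_time[OF t] have "t \<le> (length In + (k - 1 - length In)) * Suc (min \<Delta> (Suc k))"
    using In by simp
  also have "\<dots> \<le> k * Suc (min \<Delta> (Suc k))" using In by (intro mult_right_mono) auto
  finally show ?thesis using t In by (simp add: is_mandatory_def)
qed

definition extension_correct :: "nat \<Rightarrow> 'a list \<Rightarrow> 'a extension \<Rightarrow> bool" where
  "extension_correct k In r = (case r of
      Full In' \<Rightarrow> distinct In' \<and> length In' = k - 1 \<and> grown A (set In) (set In')
    | Branch In' x y \<Rightarrow> distinct In' \<and> length In' < k - 1 \<and> grown A (set In) (set In') \<and>
        x \<noteq> y \<and> x \<in> frontier A (set In') \<and> y \<in> frontier A (set In')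
    | Stuck \<Rightarrow> False)"

lemma extension_correct_grown:
  "grown A (set In) (set In') \<Longrightarrow> extension_correct k In' r \<Longrightarrow> extension_correct k In r"
  by (auto simp: extension_correct_def split: extension.splits intro: grown_trans[of A "set In"])

text \<open>The potential of \<open>bfs_time\<close> again, but reading stops at the second frontier
  vertex, so 2 or 1 new entries are allowed according to whether a first one is recorded. The last
  hypothesis is the loop invariant: with nothing left to read and no candidate, \<open>In\<close>
  would be its whole component, which has at least \<open>k\<close> vertices.\<close>

lemma extend_spec:
  assumes "distinct In" "set In \<subseteq> V" "length In < k - 1" "k \<le> card (avoiding A {} (set In))"
    "distinct ws" "set ws \<subseteq> (\<Union>q \<in> set In. set (A q))" "set Q \<subseteq> set In"
    "set_option c \<subseteq> frontier A (set In)"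
    "\<forall>q \<in> set In - set Q. set (A q) \<subseteq> set In \<union> set_option c \<union> set ws"
  shows "\<exists>r t. extend A k In c Q ws = Some (r, t) \<and> extension_correct k In r \<and>
    t \<le> read_bound ws (set In \<union> set_option c) (if c = None then 2 else 1)
      + (length Q + (k - 1 - length In)) * Suc (min \<Delta> k)"
  using assms
proof (induction "(k - length In, length Q, length ws)" arbitrary: In c Q ws
    rule: wf_induct_rule[OF wf_lex_prod[OF wf_less_than wf_lex_prod[OF wf_less_than wf_less_than]]])
  case (1 In Q ws c)
  note IH = 1(1) and a = 1(2-10)
  let ?n = "\<lambda>c. if c = (None::'a option) then 2 else 1 :: nat"
  \<comment> \<open>The candidate and the frontier vertices still missing are two in all, and
    \<open>length In' \<le> k - 2\<close>, so at most \<open>k\<close> entries are read.\<close>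
  have M: "read_bound (A q) (set In' \<union> set_option c) (?n c) \<le> min \<Delta> k"
    if "q \<in> V" "length In' < k - 1" for q In' c
  proof -
    have "card (set In' \<union> set_option c) \<le> length In' + (if c = None then 0 else 1)"
      using card_length[of "case c of None \<Rightarrow> In' | Some x \<Rightarrow> x # In'"] by (auto split: option.splits)
    moreover have "finite (set In' \<union> set_option c)" by (cases c) auto
    ultimately show ?thesis
      using read_bound_le[of "set In' \<union> set_option c" "A q" "?n c"] degree_V[OF that(1)] that(2)
      by (auto split: if_splits)
  qed
  show ?case
  proof (cases ws)
    case Nil
    show ?thesis
    proof (cases Q)
      case Q: Nil
      show ?thesis
      proof (cases c)
        case None
        have "avoiding A {} (set In) \<subseteq> set In"
          by (rule avoiding_least) (use a(9) Nil Q None in auto)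
        then have "card (avoiding A {} (set In)) \<le> length In"
          by (metis List.finite_set card_length card_mono le_trans)
        then show ?thesis using a(3,4) by simp
      next
        case (Some u)
        have u: "u \<in> frontier A (set In)" using a(8) Some by simp
        then have uIn: "u \<notin> set In" by (simp add: frontier_def)
        have uV: "u \<in> V" using u a(2) closed_V by (auto simp: frontier_def)
        have g: "grown A (set In) (set (u # In))" using grown_insert[OF u] by simp
        show ?thesis
        proof (cases "Suc (length In) = k - 1")
          case True
          have "extend A k In c Q ws = Some (Full (u # In), 1)"
            by (subst extend.simps) (simp add: Nil Q Some True ret_def)
          moreover have "extension_correct k In (Full (u # In))"
            using a(1) uIn True g by (simp add: extension_correct_def)
          moreover have "1 \<le> (length Q + (k - 1 - length In)) * Suc (min \<Delta> k)" using True by simp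
          ultimately show ?thesis by (metis trans_le_add2)
        next
          case False
          have k: "length (u # In) < k - 1" using False a(3) by simp
          have "\<exists>r t. extend A k (u # In) None [] (A u) = Some (r, t) \<and> extension_correct k (u # In) r \<and>
            t \<le> read_bound (A u) (set (u # In) \<union> set_option None) (?n None)
              + (length ([]::'a list) + (k - 1 - length (u # In))) * Suc (min \<Delta> k)"
          proof (rule IH)
            show "k \<le> card (avoiding A {} (set (u # In)))" using grown_avoiding[OF g] a(4) by simp
            show "\<forall>q \<in> set (u # In) - set []. set (A q) \<subseteq> set (u # In) \<union> set_option None \<union> set (A u)"
              using a(9) Nil Q Some by auto
          qed (use a k uV uIn distinct_V in auto)
          then obtain r t where r: "extend A k (u # In) None [] (A u) = Some (r, t)"
            "extension_correct k (u # In) r" and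
            t: "t \<le> read_bound (A u) (set (u # In) \<union> set_option None) (?n None)
              + (k - 1 - length (u # In)) * Suc (min \<Delta> k)" by auto
          have "extend A k In c Q ws = Some (r, Suc t)"
            by (subst extend.simps) (use r False in \<open>simp add: Nil Q Some\<close>)
          \<comment> \<open>One round of the loop, namely adding \<open>u\<close> and reading its
            list, is paid by the decrease of \<open>k - 1 - length In\<close>.\<close>
          moreover have "Suc t \<le> Suc (min \<Delta> k) + (k - 1 - length (u # In)) * Suc (min \<Delta> k)"
            using t M[OF uV k, of None] by linarith
          moreover have "\<dots> = (length Q + (k - 1 - length In)) * Suc (min \<Delta> k)"
          proof -
            have "k - 1 - length In = Suc (k - 1 - length (u # In))" using k by simp
            then show ?thesis by (simp only: Q list.size mult_Suc add_0)
          qed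
          moreover have "extension_correct k In r" using extension_correct_grown[OF g r(2)] .
          ultimately show ?thesis by (metis trans_le_add2)
        qed
      qed
    next
      case (Cons q Q')
      have q: "q \<in> V" "q \<in> set In" using a Cons by auto
      have "\<exists>r t. extend A k In c Q' (A q) = Some (r, t) \<and> extension_correct k In r \<and>
        t \<le> read_bound (A q) (set In \<union> set_option c) (?n c)
          + (length Q' + (k - 1 - length In)) * Suc (min \<Delta> k)"
      proof (rule IH)
        show "\<forall>q' \<in> set In - set Q'. set (A q') \<subseteq> set In \<union> set_option c \<union> set (A q)"
          using a(9) Nil Cons by auto
      qed (use a q Cons distinct_V in auto)
      then obtain r t where r: "extend A k In c Q' (A q) = Some (r, t)" "extension_correct k In r" and
        t: "t \<le> read_bound (A q) (set In \<union> set_option c) (?n c)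
          + (length Q' + (k - 1 - length In)) * Suc (min \<Delta> k)" by auto
      have "extend A k In c Q ws = Some (r, Suc t)"
        by (subst extend.simps) (use r in \<open>simp add: Nil Cons\<close>)
      moreover have "Suc t \<le> (length Q + (k - 1 - length In)) * Suc (min \<Delta> k)"
        using t M[OF q(1) a(3), of c] by (simp add: Cons del: min.bounded_iff)
      ultimately show ?thesis using r(2) by (metis trans_le_add2)
    qed
  next
    case (Cons w ws')
    have dis: "distinct (w # ws')" using a Cons by simp
    consider (old) "w \<in> set In \<union> set_option c" | (first) "w \<notin> set In" "c = None"
      | (second) u where "w \<notin> set In" "c = Some u" "u \<noteq> w" by (cases c) auto
    then show ?thesis
    proof cases
      case old
      have "\<exists>r t. extend A k In c Q ws' = Some (r, t) \<and> extension_correct k In r \<and>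
        t \<le> read_bound ws' (set In \<union> set_option c) (?n c)
          + (length Q + (k - 1 - length In)) * Suc (min \<Delta> k)"
      proof (rule IH)
        show "\<forall>q \<in> set In - set Q. set (A q) \<subseteq> set In \<union> set_option c \<union> set ws'"
          using a(9) old Cons by auto
      qed (use a Cons in auto)
      then obtain r t where r: "extend A k In c Q ws' = Some (r, t)" "extension_correct k In r" and
        t: "t \<le> read_bound ws' (set In \<union> set_option c) (?n c)
          + (length Q + (k - 1 - length In)) * Suc (min \<Delta> k)" by auto
      have "w \<in> set In \<or> c = Some w" using old by (cases c) auto
      then have "extend A k In c Q ws = Some (r, Suc t)"
        by (subst extend.simps) (use r in \<open>simp add: Cons\<close>)
      then show ?thesis using r(2) t read_bound_old[OF old dis] by (simp add: Cons)
    next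
      case first
      have fr: "w \<in> frontier A (set In)" using first a(6) Cons by (auto simp: frontier_def)
      have "\<exists>r t. extend A k In (Some w) Q ws' = Some (r, t) \<and> extension_correct k In r \<and>
        t \<le> read_bound ws' (set In \<union> set_option (Some w)) (?n (Some w))
          + (length Q + (k - 1 - length In)) * Suc (min \<Delta> k)"
      proof (rule IH)
        show "\<forall>q \<in> set In - set Q. set (A q) \<subseteq> set In \<union> set_option (Some w) \<union> set ws'"
          using a(9) first Cons by auto
      qed (use a Cons fr in auto)
      then obtain r t where r: "extend A k In (Some w) Q ws' = Some (r, t)" "extension_correct k In r" and
        t: "t \<le> read_bound ws' (insert w (set In)) 1
          + (length Q + (k - 1 - length In)) * Suc (min \<Delta> k)" by auto
      have "extend A k In c Q ws = Some (r, Suc t)"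
        by (subst extend.simps) (use r first in \<open>simp add: Cons\<close>)
      moreover have "read_bound ws (set In) 2 = Suc (read_bound ws' (insert w (set In)) 1)"
        using read_bound_new[OF first(1) dis, of 1] by (simp add: Cons numeral_2_eq_2)
      ultimately show ?thesis using r(2) t first by simp
    next
      case second
      have fr: "w \<in> frontier A (set In)" using second a(6) Cons by (auto simp: frontier_def)
      have "extend A k In c Q ws = Some (Branch In u w, 1)"
        by (subst extend.simps) (use second in \<open>auto simp: Cons ret_def\<close>)
      moreover have "extension_correct k In (Branch In u w)"
        using a(1,3,8) second fr grown_refl by (simp add: extension_correct_def)
      moreover have "1 \<le> read_bound ws (set In \<union> set_option c) (?n c)"
        using read_bound_pos[of 1 w ws' "set In \<union> set_option c"] second(2) by (simp add: Cons)
      ultimately show ?thesis by (metis trans_le_add1)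
    qed
  qed
qed

end

section \<open>Searches of the whole component\<close>

text \<open>A vertex has its list read when it receives its number, at one step per entry and one
  for the end of the list. Besides the rest of the list of \<open>p\<close>, the time is therefore
  an exact sum over the newly numbered vertices.\<close>

lemma dfs_time:
  assumes "dfs A p low sz ws (num, c, sep) = Some (((num', c', sep'), l, s), t)"
    and "finite (dom num)" "dom num \<subseteq> R" "set ws \<subseteq> R" "\<forall>u \<in> R. set (A u) \<subseteq> R"
  shows "finite (dom num') \<and> dom num \<subseteq> dom num' \<and> dom num' \<subseteq> R \<and>
    t = Suc (length ws) + (\<Sum>d \<in> dom num' - dom num. Suc (length (A d)))"
proof -
  have "finite (dom (fst st)) \<longrightarrow> dom (fst st) \<subseteq> R \<longrightarrow> set ws \<subseteq> R \<longrightarrow> (\<forall>u \<in> R. set (A u) \<subseteq> R) \<longrightarrow>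
      (let num' = fst (fst (fst r)) in finite (dom num') \<and> dom (fst st) \<subseteq> dom num' \<and> dom num' \<subseteq> R \<and>
        snd r = Suc (length ws) + (\<Sum>d \<in> dom num' - dom (fst st). Suc (length (A d))))"
    if "dfs A p low sz ws st = Some r" for st r
    using that
  proof (induction A p low sz ws st r rule: dfs.raw_induct[rotated, consumes 1, case_names step])
    case (step f A p low sz ws st r)
    note IH = step(1)
    obtain num c sep where st: "st = (num, c, sep)" by (cases st)
    show ?case
    proof (cases ws)
      case Nil
      then show ?thesis using step(2) by (auto simp: ret_def st Let_def)
    next
      case (Cons w ws')
      show ?thesis
      proof (cases "num w")
        case (Some i)
        then obtain x t' where "f A p (min low i) sz ws' st = Some (x, t')" "r = (x, Suc t')"
          using step(2) by (cases r) (auto simp: Cons st charge_eq_Some)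
        then show ?thesis using IH[of A p "min low i" sz ws' st "(x, t')"] by (auto simp: Cons Let_def)
      next
        case None
        obtain num1 c1 sep1 l1 s1 t1 low2 sz2 sep2 x t2 where
          r1: "f A w c 1 (A w) (num(w \<mapsto> c), Suc c, sep) = Some (((num1, c1, sep1), l1, s1), t1)"
          and r2: "f A p low2 sz2 ws' (num1, c1, sep2) = Some (x, t2)" and r: "r = (x, Suc (t1 + t2))"
          using step(2) None by (cases r) (auto simp: Cons st charge_eq_Some andthen_eq_Some)
        show ?thesis
        proof (intro impI)
          assume pre: "finite (dom (fst st))" "dom (fst st) \<subseteq> R" "set ws \<subseteq> R" "\<forall>u \<in> R. set (A u) \<subseteq> R"
          have w: "w \<in> R" "w \<notin> dom num" using pre Cons None by auto
          have p1: "finite (dom num1) \<and> insert w (dom num) \<subseteq> dom num1 \<and> dom num1 \<subseteq> R \<and>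
            t1 = Suc (length (A w)) + (\<Sum>d \<in> dom num1 - insert w (dom num). Suc (length (A d)))"
            using IH[OF r1] pre w st by (simp add: Let_def del: fun_upd_apply)
          let ?num2 = "fst (fst x)"
          have p2: "finite (dom ?num2) \<and> dom num1 \<subseteq> dom ?num2 \<and> dom ?num2 \<subseteq> R \<and>
            t2 = Suc (length ws') + (\<Sum>d \<in> dom ?num2 - dom num1. Suc (length (A d)))"
            using IH[OF r2] pre p1 Cons by (simp add: Let_def)
          \<comment> \<open>A disjoint decomposition: \<open>w\<close>, the vertices found below
            \<open>w\<close>, and those found after the return from \<open>w\<close>.\<close>
          have D: "dom ?num2 - dom num = insert w ((dom num1 - insert w (dom num)) \<union> (dom ?num2 - dom num1))"
            using p1 p2 w by blast
          have "(\<Sum>d \<in> dom ?num2 - dom num. Suc (length (A d))) =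
            Suc (length (A w)) + (\<Sum>d \<in> dom num1 - insert w (dom num). Suc (length (A d)))
              + (\<Sum>d \<in> dom ?num2 - dom num1. Suc (length (A d)))"
            unfolding D using p1 p2 by (subst sum.insert, blast, blast, subst sum.union_disjoint) auto
          moreover have "dom num \<subseteq> dom ?num2" using p1 p2 by blast
          ultimately show "let num' = fst (fst (fst r)) in finite (dom num') \<and> dom (fst st) \<subseteq> dom num' \<and>
            dom num' \<subseteq> R \<and> snd r = Suc (length ws) + (\<Sum>d \<in> dom num' - dom (fst st). Suc (length (A d)))"
            using p1 p2 by (simp add: Let_def st r Cons)
        qed
      qed
    qed
  qed
  from this[OF assms(1)] show ?thesis using assms by (simp add: Let_def)
qed

text \<open>The 2 per root is the charge for loading it and the charge at the end of its
  list.\<close>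

lemma dfs_roots_time:
  assumes "dfs_roots A qs n (num, c, sep) = Some (((num', c', sep'), n'), t)"
    and "finite (dom num)" "dom num \<subseteq> R" "set qs \<subseteq> R" "\<forall>u \<in> R. set (A u) \<subseteq> R"
  shows "finite (dom num') \<and> dom num \<subseteq> dom num' \<and> dom num' \<subseteq> R \<and>
    t = (\<Sum>q \<leftarrow> qs. length (A q) + 2) + (\<Sum>d \<in> dom num' - dom num. Suc (length (A d)))"
  using assms
proof (induction qs arbitrary: n num c sep t)
  case Nil
  then show ?case by (simp add: ret_def)
next
  case (Cons q qs)
  from Cons.prems(1) obtain num1 c1 sep1 l1 s1 t1 t2 where
    r1: "dfs A q 0 1 (A q) (num, c, sep) = Some (((num1, c1, sep1), l1, s1), t1)" and
    r2: "dfs_roots A qs (n + s1) (num1, c1, sep1) = Some (((num', c', sep'), n'), t2)" and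
    t: "t = Suc (t1 + t2)"
    by (auto simp: charge_eq_Some andthen_eq_Some)
  have p1: "finite (dom num1) \<and> dom num \<subseteq> dom num1 \<and> dom num1 \<subseteq> R \<and>
    t1 = Suc (length (A q)) + (\<Sum>d \<in> dom num1 - dom num. Suc (length (A d)))"
    by (rule dfs_time[OF r1]) (use Cons.prems in auto)
  have p2: "finite (dom num') \<and> dom num1 \<subseteq> dom num' \<and> dom num' \<subseteq> R \<and>
    t2 = (\<Sum>q \<leftarrow> qs. length (A q) + 2) + (\<Sum>d \<in> dom num' - dom num1. Suc (length (A d)))"
    by (rule Cons.IH[OF r2]) (use Cons.prems p1 in auto)
  have D: "dom num' - dom num = (dom num1 - dom num) \<union> (dom num' - dom num1)"
    using p1 p2 by blast
  have "(\<Sum>d \<in> dom num' - dom num. Suc (length (A d))) =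
    (\<Sum>d \<in> dom num1 - dom num. Suc (length (A d))) + (\<Sum>d \<in> dom num' - dom num1. Suc (length (A d)))"
    unfolding D using p1 p2 by (intro sum.union_disjoint) auto
  then show ?case using p1 p2 t by auto
qed

context bounded_lists
begin

text \<open>The roots and the newly numbered vertices are disjoint parts of the component of
  \<open>In\<close>, and each of them has its list read once; hence linear time in the
  component.\<close>

lemma all_mandatory_spec:
  assumes In: "distinct In" "set In \<subseteq> V"
    and L: "\<forall>u \<in> avoiding A {} (set In). length (A u) \<le> L"
  shows "\<exists>mand t. all_mandatory A In k = Some (mand, t) \<and>
    (\<forall>v \<in> avoiding A {} (set In) - set In. mand v \<longleftrightarrow> card (avoiding A {v} (set In)) \<le> k - 1) \<and>
    t \<le> length In + card (avoiding A {} (set In)) * (L + 2)"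
proof -
  interpret adj_graph A V "set In" using In(2) by (rule adj_graph_V)
  from all_mandatory_avoiding[OF In(1) refl, of k] obtain mand t where
    1: "all_mandatory A In k = Some (mand, t)"
    and 2: "\<forall>v \<in> avoiding A {} (set In) - set In. mand v \<longleftrightarrow> card (avoiding A {v} (set In)) \<le> k - 1"
    by (elim exE conjE)
  let ?R = "avoiding A {} (set In)" and ?num = "\<lambda>v. if v \<in> set In then Some (0::nat) else None"
  have finR: "finite ?R" using finite_avoiding[OF In(2)] .
  from 1 obtain num' c' sep' n t' where
    r: "dfs_roots A In 0 (?num, 1, \<lambda>_. 0) = Some (((num', c', sep'), n), t')" and t: "t = length In + t'"
    by (auto simp: all_mandatory_def charge_eq_Some andthen_eq_Some ret_def)
  have dom: "dom ?num = set In" by (auto simp: dom_def)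
  have "set In \<subseteq> ?R" by (auto intro: avoiding_base)
  then have p: "finite (dom num') \<and> set In \<subseteq> dom num' \<and> dom num' \<subseteq> ?R \<and>
    t' = (\<Sum>q \<leftarrow> In. length (A q) + 2) + (\<Sum>d \<in> dom num' - set In. Suc (length (A d)))"
    using dfs_roots_time[OF r, unfolded dom, of ?R] by (auto intro: avoiding_step)
  then have "t' = (\<Sum>q \<in> set In. length (A q) + 2) + (\<Sum>d \<in> dom num' - set In. Suc (length (A d)))"
    using In(1) by (simp add: sum_list_distinct_conv_sum_set)
  also have "\<dots> \<le> (\<Sum>q \<in> set In. length (A q) + 2) + (\<Sum>d \<in> dom num' - set In. length (A d) + 2)"
    by (intro add_left_mono sum_mono) simp
  also have "\<dots> = (\<Sum>d \<in> dom num'. length (A d) + 2)"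
    using sum.subset_diff[of "set In" "dom num'" "\<lambda>d. length (A d) + 2"] p by (simp add: add.commute)
  also have "\<dots> \<le> (\<Sum>d \<in> ?R. length (A d) + 2)" using p finR by (intro sum_mono2) auto
  also have "\<dots> \<le> (\<Sum>d \<in> ?R. L + 2)" using L by (intro sum_mono) simp
  finally have "t' \<le> card ?R * (L + 2)" by simp
  then show ?thesis using 1 2 t by auto
qed

text \<open>Lists may be read to the end here, so each queued vertex and each vertex still to be
  added costs at most \<open>Suc L\<close>. The invariant in the last hypothesis is kept only while
  no candidate is known: running out of entries without one would make \<open>In\<close> a component
  with fewer than \<open>k\<close> vertices.\<close>

lemma add_mandatory_spec:
  assumes "distinct In" "set In \<subseteq> V" "length In < k" "k \<le> card (avoiding A {} (set In))"
    "\<forall>u \<in> avoiding A {} (set In). length (A u) \<le> L"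
    "set ws \<subseteq> (\<Union>q \<in> set In. set (A q))" "set Q \<subseteq> set In"
    "set_option c \<subseteq> {w \<in> frontier A (set In). \<not> mand w}"
    "c = None \<longrightarrow> (\<forall>q \<in> set In - set Q. set (A q) \<subseteq> set In \<union> set ws)"
  shows "\<exists>In' c' t. add_mandatory A k mand In c Q ws = Some ((In', c'), t) \<and>
    distinct In' \<and> length In' \<le> k \<and> grown A (set In) (set In') \<and>
    (length In' < k \<longrightarrow> (\<exists>v \<in> frontier A (set In'). c' = Some v \<and> \<not> mand v)) \<and>
    t \<le> length ws + (length Q + (k - length In)) * Suc L"
  using assms
proof (induction "(k - length In, length Q, length ws)" arbitrary: In c Q ws
    rule: wf_induct_rule[OF wf_lex_prod[OF wf_less_than wf_lex_prod[OF wf_less_than wf_less_than]]])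
  case (1 In Q ws c)
  note IH = 1(1) and a = 1(2-10)
  show ?case
  proof (cases ws)
    case Nil
    show ?thesis
    proof (cases Q)
      case Q: Nil
      have run: "add_mandatory A k mand In c Q ws = Some ((In, c), 0)"
        by (subst add_mandatory.simps) (simp add: Nil Q ret_def)
      have "c \<noteq> None"
      proof
        assume "c = None"
        then have "avoiding A {} (set In) \<subseteq> set In"
          by (intro avoiding_least) (use a(9) Nil Q in auto)
        then have "card (avoiding A {} (set In)) \<le> length In"
          by (metis List.finite_set card_length card_mono le_trans)
        then show False using a(3,4) by simp
      qed
      then obtain v where "c = Some v" by blast
      then show ?thesis using run a(1,3,8) grown_refl by (auto intro!: bexI[of _ v])
    next
      case (Cons q Q')
      have q: "q \<in> set In" using a Cons by auto
      have "\<exists>In' c' t. add_mandatory A k mand In c Q' (A q) = Some ((In', c'), t) \<and>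
        distinct In' \<and> length In' \<le> k \<and> grown A (set In) (set In') \<and>
        (length In' < k \<longrightarrow> (\<exists>v \<in> frontier A (set In'). c' = Some v \<and> \<not> mand v)) \<and>
        t \<le> length (A q) + (length Q' + (k - length In)) * Suc L"
        by (rule IH) (use a q Cons Nil in auto)
      then obtain In' c' t where r: "add_mandatory A k mand In c Q' (A q) = Some ((In', c'), t)"
        "distinct In'" "length In' \<le> k" "grown A (set In) (set In')"
        "length In' < k \<longrightarrow> (\<exists>v \<in> frontier A (set In'). c' = Some v \<and> \<not> mand v)"
        and t: "t \<le> length (A q) + (length Q' + (k - length In)) * Suc L" by blast
      have "add_mandatory A k mand In c Q ws = Some ((In', c'), Suc t)"
        by (subst add_mandatory.simps) (use r in \<open>simp add: Nil Cons\<close>)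
      moreover have "length (A q) \<le> L" using a(5) avoiding_base[OF q] by blast
      then have "Suc t \<le> (length Q + (k - length In)) * Suc L" using t by (simp add: Cons)
      ultimately show ?thesis using r by (metis trans_le_add2)
    qed
  next
    case (Cons w ws')
    consider (old) "w \<in> set In" | (non) "w \<notin> set In" "\<not> mand w"
      | (full) "w \<notin> set In" "mand w" "Suc (length In) = k"
      | (new) "w \<notin> set In" "mand w" "Suc (length In) \<noteq> k" by blast
    then show ?thesis
    proof cases
      case old
      have "\<exists>In' c' t. add_mandatory A k mand In c Q ws' = Some ((In', c'), t) \<and>
        distinct In' \<and> length In' \<le> k \<and> grown A (set In) (set In') \<and>
        (length In' < k \<longrightarrow> (\<exists>v \<in> frontier A (set In'). c' = Some v \<and> \<not> mand v)) \<and>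
        t \<le> length ws' + (length Q + (k - length In)) * Suc L"
        by (rule IH) (use a old Cons in auto)
      moreover have "add_mandatory A k mand In c Q ws = charge 1 (add_mandatory A k mand In c Q ws')"
        by (subst add_mandatory.simps) (simp add: Cons old)
      ultimately show ?thesis by (auto simp: Cons)
    next
      case non
      then have fr: "w \<in> frontier A (set In)" using a(6) Cons by (auto simp: frontier_def)
      have "\<exists>In' c' t. add_mandatory A k mand In (Some w) Q ws' = Some ((In', c'), t) \<and>
        distinct In' \<and> length In' \<le> k \<and> grown A (set In) (set In') \<and>
        (length In' < k \<longrightarrow> (\<exists>v \<in> frontier A (set In'). c' = Some v \<and> \<not> mand v)) \<and>
        t \<le> length ws' + (length Q + (k - length In)) * Suc L"
        by (rule IH) (use a non fr Cons in auto)
      moreover have "add_mandatory A k mand In c Q ws = charge 1 (add_mandatory A k mand In (Some w) Q ws')"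
        by (subst add_mandatory.simps) (simp add: Cons non)
      ultimately show ?thesis by (auto simp: Cons)
    next
      case full
      then have fr: "w \<in> frontier A (set In)" using a(6) Cons by (auto simp: frontier_def)
      have "add_mandatory A k mand In c Q ws = Some ((w # In, None), 1)"
        by (subst add_mandatory.simps) (simp add: Cons full ret_def)
      then show ?thesis using full a(1) grown_insert[OF fr] by (auto simp: Cons)
    next
      case new
      then have fr: "w \<in> frontier A (set In)" using a(6) Cons by (auto simp: frontier_def)
      have wV: "w \<in> V" using a(2,6) Cons closed_V by auto
      have g: "grown A (set In) (set (w # In))" using grown_insert[OF fr] by simp
      have R: "avoiding A {} (set (w # In)) = avoiding A {} (set In)" using grown_avoiding[OF g] by simp
      have k: "length (w # In) < k" using new a(3) by simp
      have "\<exists>In' c' t. add_mandatory A k mand (w # In) c (Q @ [w]) ws' = Some ((In', c'), t) \<and>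
        distinct In' \<and> length In' \<le> k \<and> grown A (set (w # In)) (set In') \<and>
        (length In' < k \<longrightarrow> (\<exists>v \<in> frontier A (set In'). c' = Some v \<and> \<not> mand v)) \<and>
        t \<le> length ws' + (length (Q @ [w]) + (k - length (w # In))) * Suc L"
      proof (rule IH)
        show "k \<le> card (avoiding A {} (set (w # In)))" unfolding R by (rule a(4))
        show "\<forall>u \<in> avoiding A {} (set (w # In)). length (A u) \<le> L" unfolding R by (rule a(5))
        \<comment> \<open>The added vertex \<open>w\<close> is mandatory and the candidate is not,
          so the candidate stays outside the enlarged set.\<close>
        show "set_option c \<subseteq> {w' \<in> frontier A (set (w # In)). \<not> mand w'}"
          using a(8) new by (auto simp: frontier_def)
      qed (use a k wV new Cons in auto)
      then obtain In' c' t where r: "add_mandatory A k mand (w # In) c (Q @ [w]) ws' = Some ((In', c'), t)"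
        "distinct In'" "length In' \<le> k" "grown A (set (w # In)) (set In')"
        "length In' < k \<longrightarrow> (\<exists>v \<in> frontier A (set In'). c' = Some v \<and> \<not> mand v)"
        and t: "t \<le> length ws' + (length (Q @ [w]) + (k - length (w # In))) * Suc L" by blast
      have "add_mandatory A k mand In c Q ws = Some ((In', c'), Suc t)"
        by (subst add_mandatory.simps) (use r new in \<open>simp add: Cons\<close>)
      moreover have "length (Q @ [w]) + (k - length (w # In)) = length Q + (k - length In)"
        using k by simp
      then have "Suc t \<le> length ws + (length Q + (k - length In)) * Suc L" using t by (simp only: Cons list.size add_Suc)
      moreover have "grown A (set In) (set In')" using g r(4) by (rule grown_trans)
      ultimately show ?thesis using r by blast
    qed
  qed
qed

section \<open>Output of all extensions by one vertex\<close>

text \<open>The lists of \<open>In\<close> are read completely and may be longer than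
  \<open>k\<close>, so the entries are counted twice over. Inside \<open>In\<close> there are at
  most \<open>?m\<close> per list. Entries outside are edges to the frontier, and by symmetry each
  frontier vertex has at most \<open>?m\<close> neighbours in \<open>In\<close>; each frontier
  vertex also yields an output of its own, so there are at most \<open>?g\<close> of them.\<close>

lemma emit_all_spec:
  assumes In: "distinct In" "set In \<subseteq> V" "length In = k - 1" "0 < k" "k \<le> card (avoiding A {} (set In))"
  shows "\<exists>out t. emit_all A In = Some (out, t) \<and>
    t \<le> (4 * k * Suc (min k \<Delta>)) * card (extensions A (set In) k)"
proof -
  let ?I = "set In" and ?m = "min k \<Delta>" and ?g = "card (extensions A (set In) k)"
  define entries where "entries = concat (map A In)"
  define us where "us = remdups (filter (\<lambda>u. u \<notin> ?I) entries)"
  have us: "set us = frontier A ?I" unfolding us_def entries_def by (auto simp: frontier_def)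
  have finF: "finite (frontier A ?I)" using us by (metis List.finite_set)
  have cus: "length us = card (frontier A ?I)" using us distinct_card[of us] by (simp add: us_def)
  have cI: "card ?I = k - 1" using In distinct_card[of In] by simp
  have "inj_on (\<lambda>u. insert u ?I) (frontier A ?I)" by (rule inj_onI) (auto simp: frontier_def)
  then have "card (frontier A ?I) = card ((\<lambda>u. insert u ?I) ` frontier A ?I)" by (rule card_image[symmetric])
  also have "\<dots> \<le> ?g"
  proof (intro card_mono finite_extensions finite_avoiding In(2) image_subsetI)
    fix u assume u: "u \<in> frontier A ?I"
    then have "card (insert u ?I) = k" using cI In(4) by (simp add: frontier_def)
    then show "insert u ?I \<in> extensions A ?I k" using grown_insert[OF u] by (simp add: extensions_def)
  qed
  finally have usg: "length us \<le> ?g" using cus by simp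
  have g1: "1 \<le> ?g"
    using extensions_nonempty[OF finite_avoiding[OF In(2)], of k] In cI
      finite_extensions[OF finite_avoiding[OF In(2)], of k] by (simp add: Suc_leI card_gt_0_iff)
  have deg: "card (set (A u) \<inter> ?I) \<le> ?m" if "u \<in> V" for u
  proof -
    have "card (set (A u) \<inter> ?I) \<le> card ?I" by (intro card_mono) auto
    moreover have "card (set (A u) \<inter> ?I) \<le> card (set (A u))" by (intro card_mono) auto
    ultimately show ?thesis using cI degree_V[OF that] card_length[of "A u"] by linarith
  qed
  have FV: "frontier A ?I \<subseteq> V" using In(2) closed_V by (auto simp: frontier_def)
  have "length entries = (\<Sum>q \<in> ?I. length (A q))"
    unfolding entries_def using In(1) by (simp add: length_concat comp_def sum_list_distinct_conv_sum_set)
  also have "\<dots> = (\<Sum>q \<in> ?I. card (set (A q) \<inter> ?I) + card {u \<in> frontier A ?I. u \<in> set (A q)})"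
  proof (rule sum.cong[OF refl])
    fix q assume q: "q \<in> ?I"
    have "length (A q) = card (set (A q))" using q In distinct_V by (metis distinct_card subsetD)
    also have "set (A q) = (set (A q) \<inter> ?I) \<union> {u \<in> frontier A ?I. u \<in> set (A q)}"
      using q by (auto simp: frontier_def)
    also have "card \<dots> = card (set (A q) \<inter> ?I) + card {u \<in> frontier A ?I. u \<in> set (A q)}"
      using finF by (intro card_Un_disjoint) (auto simp: frontier_def)
    finally show "length (A q) = card (set (A q) \<inter> ?I) + card {u \<in> frontier A ?I. u \<in> set (A q)}" .
  qed
  \<comment> \<open>The edges between \<open>In\<close> and its frontier are now counted from the
    side of the frontier.\<close>
  also have "\<dots> = (\<Sum>q \<in> ?I. card (set (A q) \<inter> ?I)) + (\<Sum>u \<in> frontier A ?I. card {q \<in> ?I. u \<in> set (A q)})"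
    unfolding sum.distrib
    using sum_multicount_gen[of ?I "frontier A ?I" "\<lambda>q u. u \<in> set (A q)" "\<lambda>u. card {q \<in> ?I. u \<in> set (A q)}"] finF
    by simp
  also have "\<dots> \<le> (\<Sum>q \<in> ?I. ?m) + (\<Sum>u \<in> frontier A ?I. ?m)"
  proof (intro add_mono sum_mono)
    fix u assume u: "u \<in> frontier A ?I"
    have "{q \<in> ?I. u \<in> set (A q)} \<subseteq> set (A u) \<inter> ?I" using sym_V In(2) by blast
    then have "card {q \<in> ?I. u \<in> set (A q)} \<le> card (set (A u) \<inter> ?I)" by (intro card_mono) auto
    also have "\<dots> \<le> ?m" using u FV deg by blast
    finally show "card {q \<in> ?I. u \<in> set (A q)} \<le> ?m" .
  qed (use deg In(2) in blast)
  also have "\<dots> \<le> k * ?m + ?g * ?m"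
    using cI cus usg by (simp add: add_mono mult_right_mono)
  finally have e: "length entries \<le> k * ?m + ?g * ?m" .
  have "length In + length entries + Suc (length In) * length us \<le> k + (k * ?m + ?g * ?m) + k * ?g"
    using In(3,4) e usg by (intro add_mono mult_mono) auto
  also have "\<dots> \<le> (4 * k * Suc ?m) * ?g"
  proof -
    have "k \<le> k * ?g" "k * ?m \<le> k * ?m * ?g" "?g * ?m \<le> k * ?m * ?g"
      using g1 In(4) by simp_all
    moreover have "(4 * k * Suc ?m) * ?g = 4 * (k * ?g) + 4 * (k * ?m * ?g)" by (simp add: algebra_simps)
    ultimately show ?thesis by linarith
  qed
  finally show ?thesis
    unfolding emit_all_def Let_def entries_def[symmetric] us_def[symmetric] by (simp add: ret_def)
qed

end

section \<open>The recursion\<close>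

lemma (in bounded_lists) card_extensions_pos:
  assumes "distinct J" "set J \<subseteq> V" "length J \<le> k" "k \<le> card (avoiding A {} (set J))"
  shows "1 \<le> card (extensions A (set J) k)"
  using extensions_nonempty[of A "set J" k] finite_extensions[of A "set J" k] assms
    finite_avoiding[OF assms(2)] distinct_card[of J] by (simp add: Suc_leI card_gt_0_iff)

text \<open>\<open>B\<close> bounds the work of a single node. The \<open>B\<close> added on the
  left makes the induction close: the two calls contribute \<open>B\<close> twice, which covers the
  node itself and the \<open>B\<close> to be shown. The induction is on the number of solutions,
  which drops strictly in both calls since the other one has at least one.\<close>

lemma lin_enum_v_spec:
  fixes k \<Delta> :: nat
  defines "B \<equiv> 16 * (k * Suc (min k \<Delta>))"
  assumes "bounded_lists A V \<Delta>" "distinct In" "set In \<subseteq> V" "length In \<le> k" "0 < k"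
    "k \<le> card (avoiding A {} (set In))" "card (avoiding A {} (set In)) \<le> 2 * k"
  shows "\<exists>out t. lin_enum_v A In k = Some (out, t) \<and> t + B \<le> 2 * B * card (extensions A (set In) k)"
  using assms(2-)
proof (induction "card (extensions A (set In) k)" arbitrary: A In rule: less_induct)
  case less
  note IH = less(1) and In = less(3-5) and k0 = less(6) and R = less(7,8)
  interpret bounded_lists A V \<Delta> by (rule less(2))
  let ?R = "avoiding A {} (set In)" and ?m = "min k \<Delta>" and ?g = "\<lambda>A In. card (extensions A (set In) k)"
  let ?K = "k * Suc ?m"
  have finR: "finite ?R" using finite_avoiding[OF In(2)] .
  have cIn: "card (set J) = length J" if "distinct J" for J :: "'a list" using that by (rule distinct_card)
  have g: "1 \<le> ?g A In" by (rule card_extensions_pos) (use less.prems in auto)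
  have kK: "k \<le> ?K" "Suc ?m \<le> ?K" "1 \<le> ?K" using k0 by (simp_all del: mult_Suc_right)
  have leaf: "t + B \<le> 2 * B * ?g A In" if "t \<le> B" for t
  proof -
    have "t + B \<le> 2 * B * 1" using that by simp
    also have "\<dots> \<le> 2 * B * ?g A In" using g by (rule mult_left_mono) simp
    finally show ?thesis .
  qed
  have emit: "emit (set J) = Some ([set J], k)" if "distinct J" "length J = k" for J :: "'a list"
    using that cIn by (simp add: emit_def ret_def)
  show ?case
  proof (cases "length In = k")
    case True
    then have "lin_enum_v A In k = Some ([set In], Suc k)"
      using emit[OF In(1)] by (subst lin_enum_v.simps) simp
    moreover have "Suc k \<le> B" using kK by (simp add: B_def)
    ultimately show ?thesis using leaf by blast
  next
    case False
    then have k: "length In < k" using In by simp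
    \<comment> \<open>A vertex has all its neighbours in the component, which has at most
      \<open>2 * k\<close> vertices; the degree is also at most \<open>\<Delta>\<close>.\<close>
    have L: "\<forall>u \<in> ?R. length (A u) \<le> 2 * ?m"
    proof
      fix u assume u: "u \<in> ?R"
      then have uV: "u \<in> V" using avoiding_subset_V[OF In(2)] by blast
      have "length (A u) = card (set (A u))" using distinct_V[OF uV] by (simp add: distinct_card)
      also have "\<dots> \<le> card ?R" using finR u by (intro card_mono) (auto intro: avoiding_step)
      finally show "length (A u) \<le> 2 * ?m" using R(2) degree_V[OF uV] by simp
    qed
    obtain mand t1 where am: "all_mandatory A In k = Some (mand, t1)"
      and mand: "\<forall>v \<in> ?R - set In. mand v \<longleftrightarrow> card (avoiding A {v} (set In)) \<le> k - 1"
      and t1: "t1 \<le> length In + card ?R * (2 * ?m + 2)"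
      using all_mandatory_spec[OF In(1,2) L, of k] by blast
    obtain In' c t2 where ad: "add_mandatory A k mand In None In [] = Some ((In', c), t2)"
      and In': "distinct In'" "length In' \<le> k" and gr: "grown A (set In) (set In')"
      and c: "length In' < k \<longrightarrow> (\<exists>v \<in> frontier A (set In'). c = Some v \<and> \<not> mand v)"
      and t2: "t2 \<le> (length In + (k - length In)) * Suc (2 * ?m)"
      using add_mandatory_spec[of In k "2 * ?m" "[]" In None mand] In k R(1) L by auto
    have R': "avoiding A {} (set In') = ?R" using grown_avoiding[OF gr] by simp
    have In'V: "set In' \<subseteq> V"
      using avoiding_subset_V[OF In(2), of "{}"] R' avoiding_base[of _ "set In'" A "{}"] by blast
    have "card ?R * (2 * ?m + 2) \<le> (2 * k) * (2 * ?m + 2)" using R(2) by (rule mult_right_mono) simp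
    also have "\<dots> = 4 * ?K" by (simp add: algebra_simps)
    finally have t1K: "t1 \<le> 5 * ?K" using t1 k kK by linarith
    have "t2 \<le> k * Suc (2 * ?m)" using t2 k by simp
    also have "\<dots> \<le> k * (2 * Suc ?m)" by (rule mult_left_mono) simp_all
    finally have t2K: "t2 \<le> 2 * ?K" by simp
    show ?thesis
    proof (cases "length In' = k")
      case True
      have "lin_enum_v A In k = Some ([set In'], Suc (t1 + (length In + t2 + k)))"
        using emit[OF In'(1) True] False am ad True by (subst lin_enum_v.simps) (simp add: andthen_def)
      moreover have "Suc (t1 + (length In + t2 + k)) \<le> B" using kK t1K t2K k by (simp add: B_def)
      ultimately show ?thesis using leaf by blast
    next
      case len': False
      then have k': "length In' < k" using In' by simp
      then obtain v where v: "v \<in> frontier A (set In')" "c = Some v" "\<not> mand v" using c by blast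
      have vI: "v \<notin> set In'" using v by (simp add: frontier_def)
      have vR: "v \<in> ?R" using v R' avoiding_base[of _ "set In'" A "{}"]
        by (auto simp: frontier_def intro: avoiding_step)
      have vV: "v \<in> V" using vR avoiding_subset_V[OF In(2)] by blast
      have "v \<notin> set In" using vI gr by (auto simp: grown_def)
      then have "\<not> card (avoiding A {v} (set In)) \<le> k - 1" using mand v vR by blast
      \<comment> \<open>\<open>mand\<close> was computed for the original \<open>In\<close>; as
        \<open>v\<close> lies outside \<open>In'\<close>, its answer is still right for the enlarged
        set.\<close>
      moreover have "avoiding A {v} (set In) = avoiding (delete v A) {} (set In')"
        using grown_avoiding[OF gr, of "{v}"] vI by (simp add: avoiding_delete)
      ultimately have kd: "k \<le> card (avoiding (delete v A) {} (set In'))" by simp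
      have "avoiding (delete v A) {} (set In') \<subseteq> ?R"
        unfolding avoiding_delete[OF vI] R'[symmetric] by (rule avoiding_mono) auto
      then have dk: "card (avoiding (delete v A) {} (set In')) \<le> 2 * k"
        using card_mono[OF finR] R(2) le_trans by blast
      have R1: "avoiding A {} (set (v # In')) = ?R" using grown_avoiding[OF grown_insert[OF v(1)]] R' by simp
      let ?g1 = "?g A (v # In')" and ?g2 = "?g (delete v A) In'"
      have g1: "1 \<le> ?g1"
        by (rule card_extensions_pos) (use less.prems In' k' In'V vI vV R1 in auto)
      have g2: "1 \<le> ?g2"
        by (rule bounded_lists.card_extensions_pos[OF bounded_lists_delete]) (use In' In'V kd in auto)
      have "?g1 + ?g2 \<le> ?g A In'"
        using card_extensions_branch[OF _ v(1), of k] R' finR by simp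
      also have "\<dots> \<le> ?g A In" by (rule card_extensions_grown[OF finR gr])
      finally have gg: "?g1 + ?g2 \<le> ?g A In" .
      have "\<exists>out t. lin_enum_v A (v # In') k = Some (out, t) \<and> t + B \<le> 2 * B * ?g1"
        by (rule IH) (use gg g2 less.prems In' k' In'V vI vV R1 in auto)
      then obtain out1 t3 where l1: "lin_enum_v A (v # In') k = Some (out1, t3)" "t3 + B \<le> 2 * B * ?g1" by blast
      have "\<exists>out t. lin_enum_v (delete v A) In' k = Some (out, t) \<and> t + B \<le> 2 * B * ?g2"
        by (rule IH) (use gg g1 k0 In' In'V kd dk bounded_lists_delete in auto)
      then obtain out2 t4 where l2: "lin_enum_v (delete v A) In' k = Some (out2, t4)" "t4 + B \<le> 2 * B * ?g2" by blast
      have "lin_enum_v A In k = Some (out1 @ out2, Suc (t1 + (length In + t2 + (t3 + (deletion_time v A + t4)))))"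
        by (subst lin_enum_v.simps)
          (use False am ad len' v(2) l1(1) l2(1) in \<open>simp add: andthen_def ret_def add.assoc\<close>)
      moreover have "Suc (t1 + (length In + t2 + (t3 + (deletion_time v A + t4)))) + B \<le> 2 * B * ?g A In"
      proof -
        have "deletion_time v A \<le> 4 * Suc ?m" using L vR by (auto simp: deletion_time_def)
        then have "Suc (t1 + length In + t2 + deletion_time v A) \<le> B"
          using kK t1K t2K k by (simp add: B_def)
        moreover have "2 * B * (?g1 + ?g2) \<le> 2 * B * ?g A In" using gg by (rule mult_left_mono) simp
        ultimately show ?thesis using l1(2) l2(2) unfolding distrib_left by linarith
      qed
      ultimately show ?thesis by blast
    qed
  qed
qed

text \<open>If two vertices of \<open>N(In)\<close> are both mandatory then the component of \<open>In\<close> is covered by two sets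
  of fewer than \<open>k\<close> vertices.\<close>

lemma avoiding_frontier_Un:
  assumes "x \<in> frontier A B" "y \<in> frontier A B" "x \<noteq> y"
  shows "avoiding A {} B \<subseteq> avoiding A {x} B \<union> avoiding A {y} B"
proof (rule avoiding_least)
  have xy: "x \<in> avoiding A {y} B" "y \<in> avoiding A {x} B"
    using assms by (auto simp: frontier_def intro: avoiding_base avoiding_step)
  fix u w assume "u \<in> avoiding A {x} B \<union> avoiding A {y} B" "w \<in> set (A u)"
  then show "w \<in> avoiding A {x} B \<union> avoiding A {y} B"
    using xy avoiding_step[of u A "{x}" B w] avoiding_step[of u A "{y}" B w] by blast
qed (auto intro: avoiding_base)

text \<open>The summand \<open>2 * g * (k - |In|)\<close> pays for the deletions: deleting a vertex \<open>z\<close> of large degree is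
  charged to the graphlets that contain \<open>z\<close>, and each of these is charged at most once for each of its
  vertices outside \<open>In\<close>.\<close>

lemma enum_v_spec:
  fixes k \<Delta> :: nat
  defines "B \<equiv> 16 * (k * Suc (min k \<Delta>))"
  assumes "bounded_lists A V \<Delta>" "distinct In" "set In \<subseteq> V" "length In < k"
    "k \<le> card (avoiding A {} (set In))"
  shows "\<exists>out t. enum_v A In k = Some (out, t) \<and>
    t + B \<le> 3 * B * card (extensions A (set In) k) + 2 * card (extensions A (set In) k) * (k - length In)"
  using assms(2-)
proof (induction "card (extensions A (set In) k)" arbitrary: A In rule: less_induct)
  case less
  note IH = less(1) and In = less(3-5) and R = less(6)
  interpret bounded_lists A V \<Delta> by (rule less(2))
  let ?R = "avoiding A {} (set In)" and ?m = "min k \<Delta>" and ?g = "\<lambda>A In. card (extensions A (set In) k)"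
  let ?K = "k * Suc ?m"
  have finR: "finite ?R" using finite_avoiding[OF In(2)] .
  have k0: "0 < k" using In by simp
  have g: "1 \<le> ?g A In" by (rule card_extensions_pos) (use less.prems in auto)
  have Bg: "B \<le> B * ?g A In" using g by simp
  have kK: "k \<le> ?K" "Suc ?m \<le> ?K" "1 \<le> ?K" using k0 by (simp_all del: mult_Suc_right)
  show ?case
  proof (cases "length In = k - 1")
    case True
    obtain out t where e: "emit_all A In = Some (out, t)" "t \<le> (4 * k * Suc ?m) * ?g A In"
      using emit_all_spec[OF In(1,2) True k0 R] by blast
    have "enum_v A In k = Some (out, Suc t)"
      by (subst enum_v.simps) (use True In(3) e(1) in simp)
    \<comment> \<open>Unlike in LIN-ENUM-V, a leaf may emit many solutions, so its time is bounded
      by \<open>B\<close> per solution.\<close>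
    moreover have "Suc t + B \<le> 3 * B * ?g A In"
    proof -
      have "(4 * k * Suc ?m) * ?g A In \<le> B * ?g A In"
        unfolding B_def by (rule mult_right_mono) simp_all
      moreover have "1 \<le> B" using kK by (simp add: B_def)
      ultimately show ?thesis using e(2) Bg unfolding mult.assoc by linarith
    qed
    ultimately show ?thesis by (metis trans_le_add1)
  next
    case False
    then have k: "length In < k - 1" using In by simp
    obtain r t0 where ex: "extend A k In None In [] = Some (r, t0)" "extension_correct k In r"
      and t0: "t0 \<le> (length In + (k - 1 - length In)) * Suc (min \<Delta> k)"
      using extend_spec[of In k "[]" In None] In k R by auto
    have "t0 \<le> (k - 1) * Suc ?m" using t0 k by (simp add: min.commute)
    also have "\<dots> \<le> ?K" by (rule mult_right_mono) simp_all
    finally have t0K: "t0 \<le> ?K" .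
    have start: "enum_v A In k = charge 1 (Some (r, length In + t0) \<rhd> (\<lambda>r. case r of
           Full In' \<Rightarrow> emit_all A In'
         | Stuck \<Rightarrow> ret []
         | Branch In' x y \<Rightarrow>
             is_mandatory A In' k x \<rhd> (\<lambda>mx.
             (if mx then is_mandatory A In' k y else ret False) \<rhd> (\<lambda>mxy.
             if mxy then lin_enum_v A In' k
             else let z = (if mx then y else x) in
               enum_v A (z # In') k \<rhd> (\<lambda>out1.
               charge (deletion_time z A) (enum_v (delete z A) In' k) \<rhd> (\<lambda>out2.
               ret (out1 @ out2)))))))"
      by (subst enum_v.simps) (use False In(3) ex in simp)
    show ?thesis
    proof (cases r)
      case Stuck
      then show ?thesis using ex(2) by (simp add: extension_correct_def)
    next
      case (Full In')
      have In': "distinct In'" "length In' = k - 1" and gr: "grown A (set In) (set In')"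
        using ex(2) Full by (auto simp: extension_correct_def)
      have R': "avoiding A {} (set In') = ?R" using grown_avoiding[OF gr] by simp
      have In'V: "set In' \<subseteq> V"
        using avoiding_subset_V[OF In(2), of "{}"] R' avoiding_base[of _ "set In'" A "{}"] by blast
      obtain out t where e: "emit_all A In' = Some (out, t)" "t \<le> (4 * k * Suc ?m) * ?g A In'"
        using emit_all_spec[OF In'(1) In'V In'(2) k0] R R' by auto
      have "enum_v A In k = Some (out, Suc (length In + t0 + t))"
        using e(1) by (simp add: start Full andthen_def)
      moreover have "Suc (length In + t0 + t) + B \<le> 3 * B * ?g A In"
      proof -
        have "(4 * k * Suc ?m) * ?g A In' \<le> B * ?g A In"
          by (rule mult_mono) (auto simp: B_def card_extensions_grown[OF finR gr])
        moreover have "Suc (length In + t0) \<le> B" using kK t0K k by (simp add: B_def)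
        ultimately show ?thesis using e(2) Bg unfolding mult.assoc by linarith
      qed
      ultimately show ?thesis by (metis trans_le_add1)
    next
      case (Branch In' x y)
      have In': "distinct In'" "length In' < k - 1" and gr: "grown A (set In) (set In')"
        and x: "x \<in> frontier A (set In')" and y: "y \<in> frontier A (set In')" and xy: "x \<noteq> y"
        using ex(2) Branch by (auto simp: extension_correct_def)
      have k': "length In' < k" using In' by simp
      have R': "avoiding A {} (set In') = ?R" using grown_avoiding[OF gr] by simp
      have In'V: "set In' \<subseteq> V"
        using avoiding_subset_V[OF In(2), of "{}"] R' avoiding_base[of _ "set In'" A "{}"] by blast
      have len: "length In \<le> length In'"
        using gr card_mono[of "set In'" "set In"] In(1) In'(1) by (simp add: grown_def distinct_card)
      have test: "\<exists>t. is_mandatory A In' k v = Some (card (avoiding A {v} (set In')) \<le> k - 1, t) \<and> t \<le> 3 * ?K"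
        if "v \<in> frontier A (set In')" for v
      proof -
        have "k * Suc (min \<Delta> (Suc k)) \<le> k * (2 * Suc ?m)" by (rule mult_left_mono) auto
        then have "k + k * Suc (min \<Delta> (Suc k)) \<le> 3 * ?K" using kK(1) by linarith
        then show ?thesis
          using is_mandatory_spec[OF In'(1) In'V k', of v] that le_trans by (fastforce simp: frontier_def)
      qed
      let ?mand = "\<lambda>v. card (avoiding A {v} (set In')) \<le> k - 1"
      obtain t1 where t1: "is_mandatory A In' k x = Some (?mand x, t1)" "t1 \<le> 3 * ?K" using test[OF x] by blast
      obtain t2' where t2': "is_mandatory A In' k y = Some (?mand y, t2')" "t2' \<le> 3 * ?K" using test[OF y] by blast
      define t2 where "t2 = (if ?mand x then t2' else 0)"
      have t2: "(if ?mand x then is_mandatory A In' k y else ret False) = Some (?mand x \<and> ?mand y, t2)" "t2 \<le> 3 * ?K"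
        using t2' by (auto simp: t2_def ret_def)
      \<comment> \<open>Besides the searches, the node pays \<open>2 + 2 * k\<close>, the part of a
        deletion that is not charged to the solutions containing the deleted vertex.\<close>
      have node: "Suc (length In + t0 + t1 + t2) + (2 + 2 * k) \<le> B"
        using kK t0K t1(2) t2(2) k by (simp add: B_def)
      show ?thesis
      proof (cases "?mand x \<and> ?mand y")
        case True
        have "card ?R \<le> card (avoiding A {x} (set In') \<union> avoiding A {y} (set In'))"
          using avoiding_frontier_Un[OF x y xy] finite_avoiding[OF In'V] R' by (intro card_mono) auto
        also have "\<dots> \<le> 2 * k" using True card_Un_le le_trans
          by (smt (verit) add_le_mono diff_le_self mult_2)
        finally have "card ?R \<le> 2 * k" .
        then obtain out t where l: "lin_enum_v A In' k = Some (out, t)" "t + B \<le> 2 * B * ?g A In'"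
          using lin_enum_v_spec[OF less(2) In'(1) In'V less_imp_le[OF k'] k0] R R' unfolding B_def by auto
        have "enum_v A In k = Some (out, Suc (length In + t0 + (t1 + (t2 + t))))"
          using t1(1) t2(1) l(1) True by (simp add: start Branch andthen_def)
        \<comment> \<open>Here the factor 3 arises: 2 from LIN-ENUM-V, and 1 for the work of the
          node that hands over to it.\<close>
        moreover have "Suc (length In + t0 + (t1 + (t2 + t))) + B \<le> 3 * B * ?g A In"
        proof -
          have "2 * B * ?g A In' \<le> 2 * B * ?g A In"
            using card_extensions_grown[OF finR gr] by (rule mult_left_mono) simp
          then show ?thesis using node l(2) Bg unfolding mult.assoc by linarith
        qed
        ultimately show ?thesis by (metis trans_le_add1)
      next
        case nm: False
        define z where "z = (if ?mand x then y else x)"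
        have z: "z \<in> frontier A (set In')" "\<not> ?mand z" using x y nm by (auto simp: z_def)
        have zI: "z \<notin> set In'" using z by (simp add: frontier_def)
        have zV: "z \<in> V" using z closed_V In'V by (auto simp: frontier_def)
        have kd: "k \<le> card (avoiding (delete z A) {} (set In'))" using z(2) avoiding_delete[OF zI] by simp
        have R1: "avoiding A {} (set (z # In')) = ?R" using grown_avoiding[OF grown_insert[OF z(1)]] R' by simp
        let ?g1 = "?g A (z # In')" and ?g2 = "?g (delete z A) In'"
        have g1: "1 \<le> ?g1"
          by (rule card_extensions_pos) (use less.prems In' k' In'V zI zV R1 in auto)
        have g2: "1 \<le> ?g2"
          by (rule bounded_lists.card_extensions_pos[OF bounded_lists_delete]) (use In' k' In'V kd in auto)
        have "?g1 + ?g2 \<le> ?g A In'"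
          using card_extensions_branch[OF _ z(1), of k] R' finR by simp
        also have "\<dots> \<le> ?g A In" by (rule card_extensions_grown[OF finR gr])
        finally have gg: "?g1 + ?g2 \<le> ?g A In" .
        have "\<exists>out t. enum_v A (z # In') k = Some (out, t) \<and>
          t + B \<le> 3 * B * ?g1 + 2 * ?g1 * (k - length (z # In'))"
          by (rule IH) (use gg g2 less.prems In' In'V zI zV R1 in auto)
        then obtain out1 t3 where e1: "enum_v A (z # In') k = Some (out1, t3)"
          "t3 + B \<le> 3 * B * ?g1 + 2 * ?g1 * (k - length (z # In'))" by blast
        have "\<exists>out t. enum_v (delete z A) In' k = Some (out, t) \<and>
          t + B \<le> 3 * B * ?g2 + 2 * ?g2 * (k - length In')"
          by (rule IH) (use gg g1 In' k' In'V kd bounded_lists_delete in auto)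
        then obtain out2 t4 where e2: "enum_v (delete z A) In' k = Some (out2, t4)"
          "t4 + B \<le> 3 * B * ?g2 + 2 * ?g2 * (k - length In')" by blast
        have run: "enum_v A In k = Some (out1 @ out2,
            Suc (length In + t0 + (t1 + (t2 + (t3 + (deletion_time z A + t4))))))"
          by (cases "?mand x") (use t1(1) t2(1) e1(1) e2(1) nm in
            \<open>simp_all add: start Branch andthen_def ret_def Let_def z_def add.assoc\<close>)
        have "length (A z) \<le> ?g1 + k"
        proof (rule degree_le_extensions)
          show "finite (avoiding A {} (set (z # In')))" using R1 finR by simp
          show "card (set (z # In')) < k" using zI In' by (simp add: distinct_card)
        qed (use distinct_V[OF zV] in auto)
        then have del: "deletion_time z A \<le> 2 + 2 * k + 2 * ?g1" by (simp add: deletion_time_def)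
        \<comment> \<open>Solutions containing \<open>z\<close> have one vertex fewer left to be
          charged for; this unit pays the \<open>2 * ?g1\<close> of the deletion.\<close>
        have "k - length In' = Suc (k - length (z # In'))" using k' by simp
        then have "2 * ?g1 + 2 * ?g1 * (k - length (z # In')) + 2 * ?g2 * (k - length In')
            = 2 * (?g1 + ?g2) * (k - length In')"
          by (simp add: algebra_simps)
        also have "\<dots> \<le> 2 * ?g A In * (k - length In)" using gg len by (intro mult_mono) auto
        finally have pay: "2 * ?g1 + 2 * ?g1 * (k - length (z # In')) + 2 * ?g2 * (k - length In')
            \<le> 2 * ?g A In * (k - length In)" .
        have "3 * B * ?g1 + 3 * B * ?g2 \<le> 3 * B * ?g A In"
          unfolding distrib_left[symmetric] using gg by (rule mult_left_mono) simp
        then have "Suc (length In + t0 + (t1 + (t2 + (t3 + (deletion_time z A + t4))))) + B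
            \<le> 3 * B * ?g A In + 2 * ?g A In * (k - length In)"
          using node del pay e1(2) e2(2) by linarith
        with run show ?thesis by blast
      qed
    qed
  qed
qed

section \<open>Application to a connected graph\<close>

lemma (in graph) bounded_lists_adjacency:
  assumes "adjacency_lists G A"
  shows "bounded_lists A (verts G) (max_degree G)"
proof
  interpret adj_graph A "verts G" "{}" using assms by (intro adj_graph) auto
  fix u assume u: "u \<in> verts G"
  show "set (A u) \<subseteq> verts G" using closed[OF u] by blast
  show "u \<in> set (A w)" if "w \<in> set (A u)" for w using sym[OF u that] .
  show d: "distinct (A u)" using assms u by (simp add: adjacency_lists_def)
  have "set (A u) = head G ` out_arcs G u"
    using assms u by (auto simp: adjacency_lists_def arcs_ends_def arc_to_ends_def image_iff)
  then have "card (set (A u)) \<le> out_degree G u"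
    using finite_out_arcs by (simp add: out_degree_def card_image_le)
  also have "\<dots> \<le> max_degree G"
    unfolding max_degree_def using u by (intro Max_ge) auto
  finally show "length (A u) \<le> max_degree G" using d by (simp add: distinct_card)
qed (rule finite_verts)

lemma (in graph) enum_v_time:
  assumes "connected G" "adjacency_lists G A" "v \<in> verts G" "0 < k" "k \<le> card (verts G)"
  shows "\<exists>out t. enum_v A [v] k = Some (out, t) \<and>
    t \<le> 50 * (card (graphlets_at G k v) * (k * Suc (min k (max_degree G))))"
proof -
  let ?K = "k * Suc (min k (max_degree G))" and ?g = "card (extensions A {v} k)"
  interpret bounded_lists A "verts G" "max_degree G" by (rule bounded_lists_adjacency[OF assms(2)])
  have R: "avoiding A {} {v} = verts G" by (rule avoiding_verts[OF assms(2,3,1)])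
  have "finite (graphlets_at G k v)"
    by (rule finite_subset[of _ "Pow (verts G)"]) (auto simp: graphlets_at_def)
  then have gN: "?g \<le> card (graphlets_at G k v)"
    using extensions_graphlets[OF assms(2,3)] by (intro card_mono)
  have g: "1 \<le> ?g"
    using extensions_nonempty[of A "{v}" k] finite_extensions[of A "{v}" k] R assms(4,5) finite_verts
    by (simp add: Suc_leI card_gt_0_iff)
  have "\<exists>out t. enum_v A [v] k = Some (out, t) \<and> t \<le> 50 * (?g * ?K)"
  \<comment> \<open>\<open>enum_v_spec\<close> requires \<open>length In < k\<close>, so for
    \<open>k = 1\<close> the run is computed directly: one step for the call and one for the
    output.\<close>
  proof (cases "k = 1")
    case True
    have "enum_v A [v] k = Some ([{v}], 2)"
      by (subst enum_v.simps) (simp add: True emit_def ret_def)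
    moreover have "1 \<le> ?g * ?K" using g True by simp
    ultimately show ?thesis by auto
  next
    case False
    obtain out t where e: "enum_v A [v] k = Some (out, t)"
      "t \<le> 3 * (16 * ?K) * ?g + 2 * ?g * (k - 1)"
      using enum_v_spec[OF bounded_lists_axioms, of "[v]" k] False assms R by fastforce
    \<comment> \<open>The constant 50 is \<open>3 * 16\<close> from the nodes plus 2 from the
      deletions.\<close>
    have "2 * ?g * (k - 1) \<le> 2 * ?g * ?K" by (rule mult_left_mono) (use assms(4) in auto)
    then have "t \<le> 50 * (?g * ?K)" using e(2) by (simp add: algebra_simps)
    with e(1) show ?thesis by blast
  qed
  moreover have "50 * (?g * ?K) \<le> 50 * (card (graphlets_at G k v) * ?K)" using gN by simp
  ultimately show ?thesis using le_trans by blast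
qed

theorem theorem5:
  shows "(\<exists>C::nat. \<forall>(G :: ('a, 'b) pre_digraph) A v\<^sub>i k.
            graph G \<and> connected G \<and> adjacency_lists G A \<and> v\<^sub>i \<in> verts G \<and>
            0 < k \<and> k \<le> card (verts G) \<and> 0 < max_degree G \<longrightarrow>
            (\<exists>out t. enum_v A [v\<^sub>i] k = Some (out, t) \<and>
               t \<le> C * (card (graphlets_at G k v\<^sub>i) * k * min k (max_degree G))))
       \<and> (\<forall>D::nat. \<exists>C::nat. \<forall>(G :: ('a, 'b) pre_digraph) A v\<^sub>i k.
            graph G \<and> connected G \<and> adjacency_lists G A \<and> v\<^sub>i \<in> verts G \<and>
            0 < k \<and> k \<le> card (verts G) \<and> max_degree G \<le> D \<longrightarrow>
            (\<exists>out t. enum_v A [v\<^sub>i] k = Some (out, t) \<and>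
               t \<le> C * (k * card (graphlets_at G k v\<^sub>i))))"
proof (intro conjI allI)
  show "\<exists>C::nat. \<forall>(G :: ('a, 'b) pre_digraph) A v k.
            graph G \<and> connected G \<and> adjacency_lists G A \<and> v \<in> verts G \<and>
            0 < k \<and> k \<le> card (verts G) \<and> 0 < max_degree G \<longrightarrow>
            (\<exists>out t. enum_v A [v] k = Some (out, t) \<and>
               t \<le> C * (card (graphlets_at G k v) * k * min k (max_degree G)))"
  \<comment> \<open>\<open>100 = 50 * 2\<close>: with \<open>k\<close> and \<open>\<Delta>\<close>
    positive the minimum is at least 1, so its successor is at most twice the minimum. For
    \<open>\<Delta> = 0\<close> the claimed bound would be 0.\<close>
  proof (intro exI[of _ 100] allI impI)
    fix G :: "('a, 'b) pre_digraph" and A v and k :: nat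
    assume a: "graph G \<and> connected G \<and> adjacency_lists G A \<and> v \<in> verts G \<and>
            0 < k \<and> k \<le> card (verts G) \<and> 0 < max_degree G"
    let ?g = "card (graphlets_at G k v)" and ?m = "min k (max_degree G)"
    obtain out t where t: "enum_v A [v] k = Some (out, t)" "t \<le> 50 * (?g * (k * Suc ?m))"
      using graph.enum_v_time[of G A v k] a by blast
    have "50 * (?g * (k * Suc ?m)) \<le> 50 * (?g * (k * (2 * ?m)))"
      using a by (intro mult_left_mono) auto
    also have "\<dots> = 100 * (?g * k * ?m)" by simp
    finally show "\<exists>out t. enum_v A [v] k = Some (out, t) \<and> t \<le> 100 * (?g * k * ?m)"
      using t le_trans by blast
  qed
next
  fix D :: nat
  show "\<exists>C::nat. \<forall>(G :: ('a, 'b) pre_digraph) A v k.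
            graph G \<and> connected G \<and> adjacency_lists G A \<and> v \<in> verts G \<and>
            0 < k \<and> k \<le> card (verts G) \<and> max_degree G \<le> D \<longrightarrow>
            (\<exists>out t. enum_v A [v] k = Some (out, t) \<and> t \<le> C * (k * card (graphlets_at G k v)))"
  \<comment> \<open>Keeping the successor, which is at most \<open>Suc D\<close>, lets this version
    include \<open>\<Delta> = 0\<close>.\<close>
  proof (intro exI[of _ "50 * Suc D"] allI impI)
    fix G :: "('a, 'b) pre_digraph" and A v and k :: nat
    assume a: "graph G \<and> connected G \<and> adjacency_lists G A \<and> v \<in> verts G \<and>
            0 < k \<and> k \<le> card (verts G) \<and> max_degree G \<le> D"
    let ?g = "card (graphlets_at G k v)" and ?m = "min k (max_degree G)"
    obtain out t where t: "enum_v A [v] k = Some (out, t)" "t \<le> 50 * (?g * (k * Suc ?m))"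
      using graph.enum_v_time[of G A v k] a by blast
    have "50 * (?g * (k * Suc ?m)) \<le> 50 * (?g * (k * Suc D))"
      using a by (intro mult_left_mono) auto
    also have "\<dots> = 50 * Suc D * (k * ?g)" by (simp add: algebra_simps)
    finally show "\<exists>out t. enum_v A [v] k = Some (out, t) \<and> t \<le> 50 * Suc D * (k * ?g)"
      using t le_trans by blast
  qed
qed

end
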